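(* Let $f:\mathfrak X\to\mathbb C$ and let $z\in\mathbb R\setminus(\tau/2)\mathbb Z$. Suppose there is a doubly infinite sequence $\{f_k\}_{k\in\mathbb Z}$ of functions on $\mathfrak X$ with $f_0=f$ and $\mathcal L f_k=f_{k+1}$ for all $k\in\mathbb Z$ (so $f_k=\mathcal L^k f$ for all $k\in\mathbb Z$), and a constant $M>0$ such that $\|f_k\|_{L^{2,\infty}(\mathfrak X)}\le M|\gamma(z)|^{k}$ for all $k\in\mathbb Z$. Then $\mathcal L f=\gamma(z) f$. In particular, there exists $F\in L^{2}(\Omega)$ such that $f=\mathcal P_z F$.
   Context: $\mathfrak X$ is a homogeneous tree of degree $q+1$ with $q\ge 2$ (a connected graph without loops in which every vertex has exactly $q+1$ neighbours), identified with its vertex set, with $d(x,y)$ the number of edges on the path joining $x,y$; fix a base vertex $o$ and write $|x|=d(o,x)$. The Laplacian is $\mathcal L f(x)=f(x)-\frac{1}{q+1}\sum_{y:d(x,y)=1}f(y)$. Put $\tau=2\pi/\log q$ and $\gamma(z)=1-\frac{q^{1/2+iz}+q^{1/2-iz}}{q+1}$ for $z\in\mathbb C$. $L^{p,\infty}(\mathfrak X)$ denotes the weak $L^p$ (Lorentz) space with respect to counting measure on $\mathfrak X$. The boundary $\Omega$ is the set of infinite geodesic rays $\omega=(\omega_0=o,\omega_1,\omega_2,\dots)$ starting at $o$, equipped with the canonical probability measure $\nu$ (the set of rays passing through a given vertex $v$ with $|v|=n\ge1$ has measure $\frac{1}{(q+1)q^{n-1}}$). For $x\in\mathfrak X,\omega\in\Omega$,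 the height is $h_\omega(x)=\lim_{n\to\infty}(n-d(x,\omega_n))$, the Poisson kernel is $p(x,\omega)=q^{h_\omega(x)}$, and the Poisson transform is $\mathcal P_zF(x)=\int_\Omega p(x,\omega)^{1/2+iz}F(\omega)\,d\nu(\omega)$. *)

theory Defs
  imports "HOL-Probability.Probability"
begin

definition walk :: "('v \<Rightarrow> 'v \<Rightarrow> bool) \<Rightarrow> 'v list \<Rightarrow> bool" where
  "walk E ps \<longleftrightarrow> ps \<noteq> [] \<and> (\<forall>i. Suc i < length ps \<longrightarrow> E (ps ! i) (ps ! Suc i))"

definition is_cycle :: "('v \<Rightarrow> 'v \<Rightarrow> bool) \<Rightarrow> 'v list \<Rightarrow> bool" where
  "is_cycle E ps \<longleftrightarrow> walk E ps \<and> distinct ps \<and> 3 \<le> length ps \<and> E (last ps) (hd ps)"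

definition hom_tree :: "('v \<Rightarrow> 'v \<Rightarrow> bool) \<Rightarrow> nat \<Rightarrow> bool" where
  "hom_tree E q \<longleftrightarrow> 2 \<le> q \<and> (\<forall>x y. E x y \<longleftrightarrow> E y x) \<and> (\<forall>x. \<not> E x x)
     \<and> (\<forall>x y. \<exists>ps. walk E ps \<and> hd ps = x \<and> last ps = y)
     \<and> (\<nexists>ps. is_cycle E ps)
     \<and> (\<forall>x. finite {y. E x y} \<and> card {y. E x y} = q + 1)"

definition tdist :: "('v \<Rightarrow> 'v \<Rightarrow> bool) \<Rightarrow> 'v \<Rightarrow> 'v \<Rightarrow> nat" where
  "tdist E x y = (LEAST n. \<exists>ps. walk E ps \<and> length ps = Suc n \<and> hd ps = x \<and> last ps = y)"

definition tree_lap :: "('v \<Rightarrow> 'v \<Rightarrow> bool) \<Rightarrow> nat \<Rightarrow> ('v \<Rightarrow> complex) \<Rightarrow> 'v \<Rightarrow> complex" where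
  "tree_lap E q f x = f x - (1 / of_nat (q + 1)) * (\<Sum>y\<in>{y. E x y}. f y)"

definition tau :: "nat \<Rightarrow> real" where
  "tau q = 2 * pi / ln (real q)"

definition gam :: "nat \<Rightarrow> complex \<Rightarrow> complex" where
  "gam q z = 1 - (of_real (real q) powr (1/2 + \<i> * z) + of_real (real q) powr (1/2 - \<i> * z)) / of_nat (q + 1)"

definition weak_Lp_norm :: "real \<Rightarrow> ('v \<Rightarrow> complex) \<Rightarrow> ennreal" where
  "weak_Lp_norm p f = (SUP t\<in>{0<..}.
      (if finite {x. t < norm (f x)}
       then ennreal (t * real (card {x. t < norm (f x)}) powr (1 / p))
       else \<infinity>))"

definition boundary :: "('v \<Rightarrow> 'v \<Rightarrow> bool) \<Rightarrow> 'v \<Rightarrow> (nat \<Rightarrow> 'v) set" where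
  "boundary E x0 = {\<omega>. \<omega> 0 = x0 \<and>
      (\<forall>m n. tdist E (\<omega> m) (\<omega> n) = (if m \<le> n then n - m else m - n))}"

definition canonical_boundary_measure ::
    "('v \<Rightarrow> 'v \<Rightarrow> bool) \<Rightarrow> nat \<Rightarrow> 'v \<Rightarrow> (nat \<Rightarrow> 'v) measure \<Rightarrow> bool" where
  "canonical_boundary_measure E q x0 \<nu> \<longleftrightarrow>
     prob_space \<nu> \<and> space \<nu> = boundary E x0
     \<and> sets \<nu> = sigma_sets (boundary E x0) {{\<omega>\<in>boundary E x0. \<omega> n = v} | n v. True}
     \<and> (\<forall>v n. 1 \<le> n \<longrightarrow> tdist E x0 v = n \<longrightarrow>
          emeasure \<nu> {\<omega>\<in>boundary E x0. \<omega> n = v} = ennreal (1 / (real (q + 1) * real q ^ (n - 1))))"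

definition height :: "('v \<Rightarrow> 'v \<Rightarrow> bool) \<Rightarrow> (nat \<Rightarrow> 'v) \<Rightarrow> 'v \<Rightarrow> real" where
  "height E \<omega> x = lim (\<lambda>n. real n - real (tdist E x (\<omega> n)))"

definition poisson_kernel :: "('v \<Rightarrow> 'v \<Rightarrow> bool) \<Rightarrow> nat \<Rightarrow> 'v \<Rightarrow> (nat \<Rightarrow> 'v) \<Rightarrow> real" where
  "poisson_kernel E q x \<omega> = real q powr height E \<omega> x"

definition poisson_transform ::
    "('v \<Rightarrow> 'v \<Rightarrow> bool) \<Rightarrow> nat \<Rightarrow> (nat \<Rightarrow> 'v) measure \<Rightarrow> real \<Rightarrow> ((nat \<Rightarrow> 'v) \<Rightarrow> complex) \<Rightarrow> 'v \<Rightarrow> complex" where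
  "poisson_transform E q \<nu> z F x =
     (LINT \<omega>|\<nu>. of_real (poisson_kernel E q x \<omega>) powr (1/2 + \<i> * of_real z) * F \<omega>)"

end

theory Submission
  imports Defs
begin

text \<open>
  Put \<open>\<gamma> = \<gamma>(z)\<close>, which is positive, and \<open>g\<^sub>k = f\<^sub>k / \<gamma>\<^sup>k\<close>. A weak \<open>L\<^sup>2\<close> bound makes the sum of
  \<open>|g\<^sub>k|\<^sup>2\<close> over a ball of radius \<open>n\<close> at most linear in \<open>n\<close>, so \<open>u\<^sub>k(x) = s\<^bsup>|x|\<^esup> g\<^sub>k(x)\<close> lies in \<open>\<ell>\<^sup>2\<close> with
  \<open>\<parallel>u\<^sub>k\<parallel>\<^sup>2 = O(1 / (1 - s))\<close> uniformly in \<open>k\<close>. On the \<open>u\<^sub>k\<close> the operator \<open>\<L>/\<gamma>\<close> acts as an operator that is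
  self-adjoint up to an error \<open>d = O(1 - s)\<close> and almost positive. Hence both \<open>\<parallel>u\<^sub>k\<parallel>\<^sup>2\<close> and \<open>\<parallel>u\<^bsub>k+1\<^esub> - u\<^sub>k\<parallel>\<^sup>2\<close> are
  almost convex in \<open>k\<close>; since they are bounded over all integers, \<open>\<parallel>u\<^bsub>k+1\<^esub> - u\<^sub>k\<parallel>\<^sup>2 = O(d\<^sup>2 / (1 - s))\<close>, and
  letting \<open>s\<close> tend to 1 gives \<open>g\<^sub>1 = g\<^sub>0\<close>.

  An eigenfunction is the transform of an explicit finitely additive boundary measure. The densities
  of this measure form a martingale whose \<open>n\<close>-th squared \<open>L\<^sup>2\<close> norm is comparable to a sum of \<open>|f|\<^sup>2\<close>
  over the spheres of radius \<open>n\<close> and \<open>n - 1\<close>. These norms increase with \<open>n\<close> and have bounded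
  averages, so they are bounded, and the martingale has a limit \<open>F\<close>, with \<open>f\<close> its Poisson transform.
\<close>

subsection \<open>Geometry of the tree\<close>

lemma walk_iff_successively: "walk E ps \<longleftrightarrow> ps \<noteq> [] \<and> successively E ps"
  by (auto simp: walk_def successively_conv_nth)

text \<open>Replaces the list-based walks in the definition of \<open>tdist\<close> by relation
  powers, for which induction on one step is available.\<close>

lemma ex_walk_iff_relpowp:
  "(\<exists>ps. walk E ps \<and> length ps = Suc n \<and> hd ps = x \<and> last ps = y) \<longleftrightarrow> (E ^^ n) x y"
proof
  assume "\<exists>ps. walk E ps \<and> length ps = Suc n \<and> hd ps = x \<and> last ps = y"
  then obtain ps where ps: "walk E ps" "length ps = Suc n" "hd ps = x" "last ps = y" by blast
  then have "ps ! 0 = x" "ps ! n = y" "\<forall>i<n. E (ps ! i) (ps ! Suc i)"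
    by (auto simp: walk_def hd_conv_nth last_conv_nth)
  then show "(E ^^ n) x y"
    unfolding relpowp_fun_conv by blast
next
  assume "(E ^^ n) x y"
  then obtain f where f: "f 0 = x" "f n = y" "\<forall>i<n. E (f i) (f (Suc i))"
    unfolding relpowp_fun_conv by blast
  let ?ps = "map f [0..<Suc n]"
  have "walk E ?ps \<and> length ?ps = Suc n \<and> hd ?ps = x \<and> last ?ps = y"
    using f by (auto simp: walk_def hd_conv_nth last_conv_nth nth_append simp del: upt_Suc)
  then show "\<exists>ps. walk E ps \<and> length ps = Suc n \<and> hd ps = x \<and> last ps = y" by blast
qed

lemma tdist_eq_Least_relpowp: "tdist E x y = (LEAST n. (E ^^ n) x y)"
  by (simp add: tdist_def ex_walk_iff_relpowp)

text \<open>Loop erasure: if the next vertex has been visited already, the walk is cut back to that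
  visit instead of being extended.\<close>

lemma rtranclp_imp_distinct_walk:
  assumes "P\<^sup>*\<^sup>* x y"
  shows "\<exists>ps. walk P ps \<and> distinct ps \<and> hd ps = x \<and> last ps = y"
  using assms
proof induction
  case base
  show ?case by (rule exI[of _ "[x]"]) (auto simp: walk_iff_successively)
next
  case (step y z)
  then obtain ps where ps: "walk P ps" "distinct ps" "hd ps = x" "last ps = y" by blast
  show ?case
  proof (cases "z \<in> set ps")
    case True
    then obtain us vs where "ps = us @ z # vs" by (meson split_list)
    with ps have "walk P (us @ [z]) \<and> distinct (us @ [z]) \<and> hd (us @ [z]) = x \<and> last (us @ [z]) = z"
      by (auto simp: walk_iff_successively successively_append_iff hd_append split: if_splits)
    then show ?thesis by blast
  next
    case False
    with ps step have "walk P (ps @ [z]) \<and> distinct (ps @ [z]) \<and> hd (ps @ [z]) = x \<and> last (ps @ [z]) = z"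
      by (auto simp: walk_iff_successively successively_append_iff)
    then show ?thesis by blast
  qed
qed

locale homogeneous_tree =
  fixes E :: "'v \<Rightarrow> 'v \<Rightarrow> bool" and q :: nat
  assumes hom_tree: "hom_tree E q"
begin

lemma q_ge_2: "2 \<le> q"
  and adj_sym: "E x y \<longleftrightarrow> E y x"
  and adj_irrefl [simp]: "\<not> E x x"
  and no_cycle: "\<not> is_cycle E ps"
  and finite_nbrs [simp]: "finite {y. E x y}"
  and card_nbrs: "card {y. E x y} = q + 1"
  using hom_tree unfolding hom_tree_def by blast+

lemma ex_relpowp: "\<exists>n. (E ^^ n) x y"
proof -
  obtain ps where "walk E ps" "hd ps = x" "last ps = y"
    using hom_tree unfolding hom_tree_def by blast
  moreover from this have "length ps = Suc (length ps - 1)" by (simp add: walk_def)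
  ultimately show ?thesis using ex_walk_iff_relpowp by metis
qed

lemma relpowp_tdist: "(E ^^ tdist E x y) x y"
  unfolding tdist_eq_Least_relpowp using ex_relpowp by (rule LeastI_ex)

lemma tdist_le: "(E ^^ n) x y \<Longrightarrow> tdist E x y \<le> n"
  unfolding tdist_eq_Least_relpowp by (rule Least_le)

lemma relpowp_sym: "(E ^^ n) x y \<longleftrightarrow> (E ^^ n) y x"
proof -
  have "(E ^^ n) y x" if "(E ^^ n) x y" for x y n
    using that
  proof (induction n arbitrary: y)
    case (Suc n)
    then obtain z where "(E ^^ n) x z" "E z y" by (auto elim: relpowp_Suc_E)
    with Suc.IH have "E y z" "(E ^^ n) z x" by (auto simp: adj_sym)
    then show ?case by (rule relpowp_Suc_I2)
  qed auto
  then show ?thesis by blast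
qed

lemma tdist_sym: "tdist E x y = tdist E y x"
  unfolding tdist_eq_Least_relpowp using relpowp_sym by metis

lemma tdist_self [simp]: "tdist E x x = 0"
  using tdist_le[of 0 x x] by simp

lemma tdist_eq_0_iff [simp]: "tdist E x y = 0 \<longleftrightarrow> x = y"
  using relpowp_tdist[of x y] by auto

lemma tdist_adj_le: "E y z \<Longrightarrow> tdist E x z \<le> Suc (tdist E x y)"
  by (rule tdist_le) (use relpowp_tdist[of x y] in auto)

lemma adj_if_tdist_1: "tdist E x y = 1 \<Longrightarrow> E x y"
  using relpowp_tdist[of x y] by auto

text \<open>Two descending geodesics avoiding \<open>x\<close> would close up to a cycle through \<open>x\<close>.\<close>

lemma lower_neighbour_unique:
  assumes u: "E x u" "tdist E r u \<le> tdist E r x" and v: "E x v" "tdist E r v \<le> tdist E r x"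
  shows "u = v"
proof (rule ccontr)
  assume "u \<noteq> v"
  let ?P = "\<lambda>a b. E a b \<and> a \<noteq> x \<and> b \<noteq> x"
  \<comment> \<open>All earlier vertices on a geodesic from \<open>r\<close> to such a
    \<open>y\<close> are strictly closer to \<open>r\<close> than \<open>x\<close> is, so the
    geodesic avoids \<open>x\<close>.\<close>
  have down: "?P\<^sup>*\<^sup>* r y" if "tdist E r y \<le> tdist E r x" "y \<noteq> x" for y
    using that
  proof (induction "tdist E r y" arbitrary: y)
    case (Suc n)
    from relpowp_tdist[of r y] Suc.hyps(2) have "(E ^^ Suc n) r y" by simp
    then obtain w where w: "(E ^^ n) r w" "E w y" by (auto elim: relpowp_Suc_E)
    have "tdist E r w \<le> n" using w tdist_le by blast
    moreover have "Suc n \<le> Suc (tdist E r w)" using tdist_adj_le[OF w(2), of r] Suc.hyps(2) by simp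
    ultimately have n: "n = tdist E r w" by simp
    with Suc have "w \<noteq> x" by auto
    with Suc.hyps(1)[OF n] n Suc w have "?P\<^sup>*\<^sup>* r w" "?P w y" by auto
    then show ?case by (rule rtranclp.rtrancl_into_rtrancl)
  qed simp
  have "symp ?P" by (auto intro: sympI simp: adj_sym)
  then have "symp ?P\<^sup>*\<^sup>*" by (rule symp_rtranclp)
  moreover have "u \<noteq> x" using u by auto
  ultimately have "?P\<^sup>*\<^sup>* u r" using down[OF u(2)] by (blast dest: sympD)
  moreover have "?P\<^sup>*\<^sup>* r v" using down[of v] v by force
  ultimately have "?P\<^sup>*\<^sup>* u v" by simp
  then obtain ps where ps: "walk ?P ps" "distinct ps" "hd ps = u" "last ps = v"
    by (blast dest: rtranclp_imp_distinct_walk)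
  have ne: "ps \<noteq> []" "length ps \<noteq> 1"
    using ps \<open>u \<noteq> v\<close> by (auto simp: walk_def length_Suc_conv)
  then have len: "2 \<le> length ps" by (cases ps rule: remdups_adj.cases) auto
  have "x \<notin> set ps"
  proof
    assume "x \<in> set ps"
    then obtain i where i: "i < length ps" "ps ! i = x" by (auto simp: in_set_conv_nth)
    show False
    proof (cases i)
      case 0
      with len ps i show False by (force simp: walk_def)
    next
      case (Suc j)
      with ps i show False by (force simp: walk_def)
    qed
  qed
  moreover have "successively E ps"
    using ps(1) by (auto simp: walk_iff_successively intro: successively_mono)
  ultimately have "is_cycle E (x # ps)"
    using ps ne len u v by (auto simp: is_cycle_def walk_iff_successively successively_Cons adj_sym)
  then show False using no_cycle by blast
qed

lemma ex_lower_neighbour: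
  assumes "y \<noteq> r"
  shows "\<exists>u. E y u \<and> Suc (tdist E r u) = tdist E r y"
proof -
  obtain n where n: "tdist E r y = Suc n"
    using assms by (cases "tdist E r y") auto
  then have "(E ^^ Suc n) r y" using relpowp_tdist[of r y] by simp
  then obtain w where w: "(E ^^ n) r w" "E w y" by (auto elim: relpowp_Suc_E)
  have "tdist E r w \<le> n" using w tdist_le by blast
  moreover have "Suc n \<le> Suc (tdist E r w)" using tdist_adj_le[OF w(2), of r] n by simp
  ultimately show ?thesis using w n by (auto simp: adj_sym)
qed

text \<open>Trees are bipartite: a neighbour \<open>y\<close> of \<open>x\<close> at the same
  distance from \<open>r\<close> would compete with the neighbour of \<open>x\<close> on a geodesic
  towards \<open>r\<close>. This is where \<open>lower_neighbour_unique\<close> is used with a weak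
  inequality.\<close>

lemma tdist_adj_neq:
  assumes "E x y"
  shows "tdist E r x \<noteq> tdist E r y"
proof
  assume eq: "tdist E r x = tdist E r y"
  have "x \<noteq> r" using assms eq by (metis adj_irrefl tdist_eq_0_iff)
  then obtain u where "E x u" "Suc (tdist E r u) = tdist E r x" using ex_lower_neighbour by blast
  moreover from this have "u = y" using assms eq by (intro lower_neighbour_unique[of x u r y]) auto
  ultimately show False using eq by simp
qed

lemma tdist_adj_cases:
  assumes "E x y"
  obtains "tdist E r y = Suc (tdist E r x)" | "tdist E r x = Suc (tdist E r y)"
  using tdist_adj_le[OF assms, of r] tdist_adj_le[of y x r] assms tdist_adj_neq[OF assms, of r]
  by (auto simp: adj_sym le_Suc_eq)

text \<open>Only the logarithm of the cardinality enters later, and it has to be linear in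
  \<open>n\<close>; hence the crude count in which each vertex contributes itself and its
  \<open>q + 1\<close> neighbours.\<close>

lemma ball_finite_card:
  "finite {x. tdist E r x \<le> n} \<and> card {x. tdist E r x \<le> n} \<le> (q + 2) ^ n"
proof (induction n)
  case 0
  have "{x. tdist E r x \<le> 0} = {r}" by auto
  then show ?case by simp
next
  case (Suc n)
  let ?B = "{x. tdist E r x \<le> n}"
  have sub: "{x. tdist E r x \<le> Suc n} \<subseteq> ?B \<union> (\<Union>x\<in>?B. {y. E x y})"
  proof
    fix x assume "x \<in> {x. tdist E r x \<le> Suc n}"
    then consider "x \<in> ?B" | "tdist E r x = Suc n" by force
    then show "x \<in> ?B \<union> (\<Union>x\<in>?B. {y. E x y})"
    proof cases
      case 2
      then have "x \<noteq> r" by auto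
      then show ?thesis using ex_lower_neighbour[of x r] 2 by (auto simp: adj_sym)
    qed auto
  qed
  have fin: "finite (?B \<union> (\<Union>x\<in>?B. {y. E x y}))" using Suc by auto
  have "card {x. tdist E r x \<le> Suc n} \<le> card (?B \<union> (\<Union>x\<in>?B. {y. E x y}))"
    using sub fin by (rule card_mono[rotated])
  also have "\<dots> \<le> card ?B + card (\<Union>x\<in>?B. {y. E x y})" by (rule card_Un_le)
  also have "card (\<Union>x\<in>?B. {y. E x y}) \<le> (\<Sum>x\<in>?B. card {y. E x y})"
    using Suc by (intro card_UN_le) auto
  also have "\<dots> = card ?B * (q + 1)" by (simp add: card_nbrs)
  also have "card ?B + card ?B * (q + 1) = (q + 2) * card ?B" by simp
  also have "\<dots> \<le> (q + 2) * (q + 2) ^ n" using Suc by (intro mult_left_mono) auto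
  finally show ?case using finite_subset[OF sub fin] by simp
qed

lemmas finite_ball [simp] = ball_finite_card[THEN conjunct1]
  and card_ball = ball_finite_card[THEN conjunct2]

end

section \<open>Levels, parents and descendants with respect to a root\<close>

locale rooted_homogeneous_tree = homogeneous_tree E q
  for E :: "'v \<Rightarrow> 'v \<Rightarrow> bool" and q :: nat +
  fixes root :: 'v
begin

abbreviation lev :: "'v \<Rightarrow> nat" where "lev \<equiv> tdist E root"

text \<open>At \<open>root\<close> no such neighbour exists and the value is arbitrary, hence the
  recurring side condition \<open>x \<noteq> root\<close>.\<close>

definition parent :: "'v \<Rightarrow> 'v" where
  "parent x = (SOME u. E x u \<and> Suc (lev u) = lev x)"

definition children :: "'v \<Rightarrow> 'v set" where
  "children x = {y. E x y \<and> lev y = Suc (lev x)}"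

definition sphere :: "nat \<Rightarrow> 'v set" where
  "sphere n = {x. lev x = n}"

lemma parent:
  assumes "x \<noteq> root"
  shows "E x (parent x)" "Suc (lev (parent x)) = lev x"
  using someI_ex[OF ex_lower_neighbour[OF assms]] unfolding parent_def by auto

lemma parent_eqI: "E x u \<Longrightarrow> lev x = Suc (lev u) \<Longrightarrow> parent x = u"
  using lower_neighbour_unique[of x "parent x" root u] parent[of x] by force

lemma parent_child: "y \<in> children x \<Longrightarrow> parent y = x"
  by (auto simp: children_def adj_sym intro: parent_eqI)

lemma finite_children [simp]: "finite (children x)"
  unfolding children_def by (rule finite_subset[OF _ finite_nbrs[of x]]) auto

lemma nbrs_root: "{y. E root y} = children root"
proof -
  have "lev y = Suc 0" if "E root y" for y
    using that by (cases rule: tdist_adj_cases[of root y root]) auto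
  then show ?thesis by (auto simp: children_def)
qed

lemma nbrs_eq:
  assumes "x \<noteq> root"
  shows "{y. E x y} = insert (parent x) (children x)" "parent x \<notin> children x"
proof -
  have "y \<in> insert (parent x) (children x)" if "E x y" for y
    by (rule tdist_adj_cases[OF that, of root]) (use that in \<open>auto simp: children_def parent_eqI\<close>)
  then show "{y. E x y} = insert (parent x) (children x)"
    using parent[OF assms] by (auto simp: children_def)
  show "parent x \<notin> children x" using parent[OF assms] by (auto simp: children_def)
qed

lemma card_children: "card (children x) = (if x = root then q + 1 else q)"
  using card_nbrs[of x] nbrs_root nbrs_eq[of x] by auto

lemma finite_sphere [simp]: "finite (sphere n)"
  unfolding sphere_def by (rule finite_subset[OF _ finite_ball[of root n]]) auto

lemma sphere_0 [simp]: "sphere 0 = {root}"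
  by (auto simp: sphere_def)

lemma sphere_Suc: "sphere (Suc n) = (\<Union>x\<in>sphere n. children x)"
proof -
  have "\<exists>y. lev y = n \<and> x \<in> children y" if "lev x = Suc n" for x
  proof -
    have "x \<noteq> root" using that by auto
    from parent[OF this] that show ?thesis by (auto simp: children_def adj_sym)
  qed
  then show ?thesis by (force simp: sphere_def children_def)
qed

lemma sum_sphere_Suc:
  fixes F :: "'v \<Rightarrow> 'b::comm_monoid_add"
  shows "(\<Sum>x\<in>sphere (Suc n). F x) = (\<Sum>x\<in>sphere n. \<Sum>y\<in>children x. F y)"
  unfolding sphere_Suc
  by (rule sum.UNION_disjoint) (auto dest: parent_child)

lemma sum_ball_spheres:
  fixes F :: "'v \<Rightarrow> 'b::comm_monoid_add"
  shows "(\<Sum>x | lev x \<le> n. F x) = (\<Sum>j\<le>n. \<Sum>x\<in>sphere j. F x)"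
proof -
  have "{x. lev x \<le> n} = (\<Union>j\<in>{..n}. sphere j)" by (auto simp: sphere_def)
  then show ?thesis
    by (simp only:, intro sum.UNION_disjoint) (simp, simp, auto simp: sphere_def)
qed

text \<open>The level condition bounds the number of iterations, so that \<open>parent\<close> is
  never applied at the root, where its value is arbitrary.\<close>

definition descendant :: "'v \<Rightarrow> 'v \<Rightarrow> bool" where
  "descendant v w \<longleftrightarrow> (\<exists>j. lev w = lev v + j \<and> (parent ^^ j) w = v)"

lemma descendant_child:
  assumes "descendant v x" "y \<in> children x"
  shows "descendant v y"
proof -
  obtain j where "lev x = lev v + j" "(parent ^^ j) x = v"
    using assms by (auto simp: descendant_def)
  with assms(2) have "lev y = lev v + Suc j \<and> (parent ^^ Suc j) y = v"
    by (simp add: funpow_swap1 parent_child) (simp add: children_def parent_child funpow_Suc_right del: funpow.simps)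
  then show ?thesis unfolding descendant_def by blast
qed

lemma descendant_parent:
  assumes "descendant v x" "x \<noteq> v"
  shows "descendant v (parent x)"
proof -
  obtain j where j: "lev x = lev v + j" "(parent ^^ j) x = v"
    using assms by (auto simp: descendant_def)
  with assms obtain i where i: "j = Suc i" by (cases j) auto
  then have "x \<noteq> root" using j by auto
  then have "lev (parent x) = lev v + i \<and> (parent ^^ i) (parent x) = v"
    using parent[of x] j i by (simp add: funpow_swap1)
  then show ?thesis unfolding descendant_def by blast
qed

text \<open>The edge from \<open>v\<close> to its parent is the only one leaving the set of descendants of \<open>v\<close>.\<close>

lemma tdist_nondescendant:
  assumes v: "v \<noteq> root" and w: "\<not> descendant v w"
  shows "tdist E v w = Suc (tdist E (parent v) w)"
proof (rule antisym)
  show "tdist E v w \<le> Suc (tdist E (parent v) w)"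
    using tdist_adj_le[of "parent v" v w] parent[OF v] by (simp add: tdist_sym adj_sym)
  \<comment> \<open>Induction along a walk that starts outside the descendants of \<open>v\<close>:
    either its last step stays inside them and the induction hypothesis applies, or that step enters
    them and runs from \<open>parent v\<close> to \<open>v\<close>.\<close>
  have *: "Suc (tdist E w (parent v)) \<le> k" if "(E ^^ k) w y" "descendant v y" for k y
    using that
  proof (induction k arbitrary: y)
    case 0
    then show ?case using w by auto
  next
    case (Suc k)
    then obtain y' where y': "(E ^^ k) w y'" "E y' y" by (auto elim: relpowp_Suc_E)
    show ?case
    proof (cases "descendant v y'")
      case True
      then show ?thesis using Suc.IH y' by force
    next
      case False
      have "y' \<in> children y \<or> y \<in> children y'"
        by (rule tdist_adj_cases[OF y'(2), of root]) (use y'(2) in \<open>auto simp: children_def adj_sym\<close>)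
      then have "y' = parent y" using False Suc.prems descendant_child parent_child by blast
      then have "y = v" using False Suc.prems descendant_parent by blast
      then show ?thesis using \<open>y' = parent y\<close> y' tdist_le by auto
    qed
  qed
  have "descendant v v" by (auto simp: descendant_def)
  from *[OF relpowp_tdist this] show "Suc (tdist E (parent v) w) \<le> tdist E v w"
    by (simp add: tdist_sym)
qed

end

subsection \<open>Orbits with bounded weak norms\<close>

text \<open>The symmetrised sequence \<open>e j\<close> has second differences at least
  \<open>c\<close>. At \<open>j = 0\<close> both brackets coincide, which gives the initial slope
  \<open>c / 2\<close>; hence the slopes are at least \<open>c (j + 1/2)\<close>, and these sum to
  \<open>c j^2 / 2\<close>. The constant is applied with either sign.\<close>

lemma symmetric_second_difference:
  fixes h :: "int \<Rightarrow> real"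
  assumes "\<And>j. j < J \<Longrightarrow> c \<le> (h (m + int j + 1) - 2 * h (m + int j) + h (m + int j - 1))
      + (h (m - int j + 1) - 2 * h (m - int j) + h (m - int j - 1))"
    and "j \<le> J"
  shows "c * (real j)\<^sup>2 / 2 \<le> h (m + int j) + h (m - int j) - 2 * h m"
proof -
  define e where "e j = h (m + int j) + h (m - int j)" for j :: nat
  have e: "c \<le> e (j + 2) - 2 * e (j + 1) + e j" if "j + 1 < J" for j
    using assms(1)[OF that] by (simp add: e_def algebra_simps)
  have e0: "c \<le> 2 * (e 1 - e 0)" if "0 < J"
    using assms(1)[OF that] by (simp add: e_def algebra_simps)
  have inc: "c * (real j + 1 / 2) \<le> e (Suc j) - e j" if "j < J" for j
    using that
  proof (induction j)
    case 0
    then show ?case using e0 by (simp add: field_simps)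
  next
    case (Suc j)
    then show ?case using e[of j] by (simp add: algebra_simps)
  qed
  have "c * (real j)\<^sup>2 / 2 \<le> e j - e 0"
    using \<open>j \<le> J\<close>
  proof (induction j)
    case (Suc j)
    then show ?case using inc[of j] by (simp add: power2_eq_square algebra_simps add_divide_distrib)
  qed simp
  then show ?thesis by (simp add: e_def)
qed

text \<open>A Bernstein-type inequality. Near a maximum of \<open>\<psi>\<close>, the symmetrised \<open>\<psi>\<close> stays close to the
  supremum on a window of length \<open>J\<close>, so a large supremum would make \<open>\<phi>\<close> strongly convex there.\<close>

lemma bounded_convexity_estimate:
  fixes \<phi> \<psi> :: "int \<Rightarrow> real"
  assumes \<phi>: "\<And>k. 0 \<le> \<phi> k" "\<And>k. \<phi> k \<le> N"
    and \<psi>: "\<And>k. 0 \<le> \<psi> k" "bdd_above (range \<psi>)"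
    and conv_\<phi>: "\<And>k. \<psi> k / 4 - 4 * d\<^sup>2 * \<phi> k \<le> \<phi> (k + 2) - 2 * \<phi> (k + 1) + \<phi> k"
    and conv_\<psi>: "\<And>k. - 4 * d\<^sup>2 * \<psi> k \<le> \<psi> (k + 2) - 2 * \<psi> (k + 1) + \<psi> k"
    and J: "0 < J" "8 * d\<^sup>2 * (real J)\<^sup>2 \<le> 1"
  shows "\<psi> k \<le> N * (32 * d\<^sup>2 + 16 / (real J)\<^sup>2)"
proof -
  define B where "B = (SUP k. \<psi> k)"
  have le_B: "\<psi> k \<le> B" for k unfolding B_def by (rule cSUP_upper[OF _ \<psi>(2)]) simp
  have N: "0 \<le> N" using \<phi>(1)[of 0] \<phi>(2)[of 0] by linarith
  have "B \<le> N * (32 * d\<^sup>2 + 16 / (real J)\<^sup>2)"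
  proof (cases "B \<le> 0")
    case True
    have "0 \<le> N * (32 * d\<^sup>2 + 16 / (real J)\<^sup>2)" using N by (intro mult_nonneg_nonneg) auto
    with True show ?thesis by linarith
  next
    case False
    then have "3 / 4 * B < B" by simp
    then obtain m where m: "3 / 4 * B < \<psi> m"
      unfolding B_def using less_cSUP_iff[OF _ \<psi>(2), of "3 / 4 * (SUP k. \<psi> k)"] by auto
    have dB: "d\<^sup>2 * \<psi> k \<le> d\<^sup>2 * B" and dN: "d\<^sup>2 * \<phi> k \<le> d\<^sup>2 * N" for k
      by (rule mult_left_mono; use le_B \<phi> in simp)+
    have window: "B \<le> \<psi> (m + int j) + \<psi> (m - int j)" if "j \<le> J" for j
    proof -
      \<comment> \<open>The loss is at most \<open>4 d^2 J^2 B \<le> B / 2\<close>, and twice the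
        value at \<open>m\<close> exceeds \<open>3 B / 2\<close>, which leaves
        \<open>B\<close>.\<close>
      have 1: "(- 8 * d\<^sup>2 * B) * (real j)\<^sup>2 / 2 \<le> \<psi> (m + int j) + \<psi> (m - int j) - 2 * \<psi> m"
      proof (rule symmetric_second_difference[OF _ that])
        fix j
        show "- 8 * d\<^sup>2 * B \<le> (\<psi> (m + int j + 1) - 2 * \<psi> (m + int j) + \<psi> (m + int j - 1))
            + (\<psi> (m - int j + 1) - 2 * \<psi> (m - int j) + \<psi> (m - int j - 1))"
          using conv_\<psi>[of "m + int j - 1"] conv_\<psi>[of "m - int j - 1"]
            dB[of "m + int j - 1"] dB[of "m - int j - 1"]
          by (simp add: algebra_simps)
      qed
      have "8 * d\<^sup>2 * (real j)\<^sup>2 \<le> 8 * d\<^sup>2 * (real J)\<^sup>2"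
        using that by (intro mult_left_mono power_mono) auto
      then have "8 * d\<^sup>2 * (real j)\<^sup>2 * B \<le> 1 * B"
        using J False by (intro mult_right_mono) auto
      with 1 m show ?thesis by (simp add: algebra_simps)
    qed
    \<comment> \<open>The hypothesis at index \<open>k\<close> is a second difference centred at
      \<open>k + 1\<close>, so a window of \<psi> around \<open>m\<close> controls \<phi> around
      \<open>m + 1\<close>.\<close>
    have "(B / 4 - 8 * d\<^sup>2 * N) * (real J)\<^sup>2 / 2
        \<le> \<phi> (m + 1 + int J) + \<phi> (m + 1 - int J) - 2 * \<phi> (m + 1)"
    proof (rule symmetric_second_difference[OF _ order_refl])
      fix j assume "j < J"
      then show "B / 4 - 8 * d\<^sup>2 * N
          \<le> (\<phi> (m + 1 + int j + 1) - 2 * \<phi> (m + 1 + int j) + \<phi> (m + 1 + int j - 1))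
            + (\<phi> (m + 1 - int j + 1) - 2 * \<phi> (m + 1 - int j) + \<phi> (m + 1 - int j - 1))"
        using conv_\<phi>[of "m + int j"] conv_\<phi>[of "m - int j"] window[of j]
          dN[of "m + int j"] dN[of "m - int j"]
        by (simp add: algebra_simps)
    qed
    also have "\<dots> \<le> 2 * N"
      using \<phi>(2)[of "m + 1 + int J"] \<phi>(2)[of "m + 1 - int J"] \<phi>(1)[of "m + 1"] by linarith
    finally show ?thesis using J(1) by (simp add: field_simps)
  qed
  with le_B show ?thesis using order_trans by blast
qed

section \<open>Abel summation and weak L^2 bounds\<close>

text \<open>Abel summation: the weights decrease, so nonpositive partial sums of
  \<open>a j - C\<close> stay nonpositive after weighting.\<close>

lemma sum_power_mult_le:
  fixes a :: "nat \<Rightarrow> real"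
  assumes a: "\<And>n. (\<Sum>j\<le>n. a j) \<le> C * real (n + 1)" and r: "0 \<le> r" "r \<le> 1"
  shows "(\<Sum>j\<le>n. r ^ j * a j) \<le> C * (\<Sum>j\<le>n. r ^ j)"
proof -
  define b where "b j = a j - C" for j
  have b: "(\<Sum>j\<le>n. b j) \<le> 0" for n
    using a[of n] by (simp add: b_def sum_subtractf algebra_simps)
  have "(\<Sum>j\<le>n. r ^ j * b j) = r ^ n * (\<Sum>j\<le>n. b j) + (1 - r) * (\<Sum>i<n. r ^ i * (\<Sum>j\<le>i. b j))"
    by (induction n) (auto simp: algebra_simps lessThan_Suc_atMost[symmetric])
  also have "\<dots> \<le> 0 + 0"
    using r by (intro add_mono mult_nonneg_nonpos sum_nonpos[where A = "{..<n}"] b) auto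
  finally show ?thesis by (simp add: b_def algebra_simps sum_subtractf sum_distrib_left)
qed

text \<open>The smallest value of |f|^2 on a set of \<open>n\<close> points is at most
  \<open>K^2 / n\<close>. Removing a minimiser repeatedly bounds the sum by \<open>K^2\<close> times
  a harmonic sum, hence the logarithm.\<close>

lemma sum_norm_sq_le_of_weak_L2:
  fixes f :: "'v \<Rightarrow> complex"
  assumes K: "weak_Lp_norm 2 f \<le> ennreal K" "0 \<le> K"
    and B: "finite B" "B \<noteq> {}"
  shows "(\<Sum>x\<in>B. (cmod (f x))\<^sup>2) \<le> K\<^sup>2 * (1 + ln (real (card B)))"
  using B
proof (induction "card B" arbitrary: B)
  case (Suc n)
  have lev: "card A * t\<^sup>2 \<le> K\<^sup>2" if "t > 0" "finite A" "\<And>x. x \<in> A \<Longrightarrow> t < cmod (f x)" for t :: real and A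
  proof -
    have le: "(if finite {x. t < cmod (f x)}
       then ennreal (t * real (card {x. t < cmod (f x)}) powr (1 / 2)) else \<infinity>) \<le> ennreal K"
      using K(1) \<open>t > 0\<close> unfolding weak_Lp_norm_def SUP_le_iff by blast
    then have fin: "finite {x. t < cmod (f x)}" by (auto split: if_splits simp: top_unique)
    with le K(2) have "t * sqrt (real (card {x. t < cmod (f x)})) \<le> K"
      by (simp add: powr_half_sqrt)
    moreover have "card A \<le> card {x. t < cmod (f x)}" using fin that by (intro card_mono) auto
    then have "t * sqrt (real (card A)) \<le> t * sqrt (real (card {x. t < cmod (f x)}))"
      using that by (intro mult_left_mono) auto
    ultimately have "t * sqrt (real (card A)) \<le> K" by linarith
    then have "(t * sqrt (real (card A)))\<^sup>2 \<le> K\<^sup>2" using that by (intro power_mono) auto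
    then show ?thesis by (simp add: power_mult_distrib mult.commute)
  qed
  obtain b where b: "b \<in> B" "\<And>x. x \<in> B \<Longrightarrow> cmod (f b) \<le> cmod (f x)"
    using ex_min_if_finite[of "(\<lambda>x. cmod (f x)) ` B"] Suc by (force simp: not_less)
  \<comment> \<open>The level sets in the weak norm are strict, so the threshold |f b| itself is
    reached only as a limit from the left.\<close>
  have "real (card B) * (cmod (f b))\<^sup>2 \<le> K\<^sup>2"
  proof (cases "f b = 0")
    case False
    have "(\<lambda>t. real (card B) * t\<^sup>2) \<midarrow>cmod (f b)\<rightarrow> real (card B) * (cmod (f b))\<^sup>2"
      by (intro tendsto_intros)
    then have lim: "((\<lambda>t. real (card B) * t\<^sup>2) \<longlongrightarrow> real (card B) * (cmod (f b))\<^sup>2) (at_left (cmod (f b)))"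
      by (rule tendsto_mono[rotated]) (simp add: at_le)
    have "\<forall>\<^sub>F t in at_left (cmod (f b)). real (card B) * t\<^sup>2 \<le> K\<^sup>2"
    proof (rule eventually_mono[OF eventually_at_left_real[of 0 "cmod (f b)"]])
      show "0 < cmod (f b)" using False by simp
      show "real (card B) * t\<^sup>2 \<le> K\<^sup>2" if "t \<in> {0<..<cmod (f b)}" for t
      proof (rule lev)
        show "t < cmod (f x)" if "x \<in> B" for x using b(2)[OF that] \<open>t \<in> _\<close> by simp
      qed (use that Suc.prems(1) in auto)
    qed
    from tendsto_upperbound[OF lim this] show ?thesis by simp
  qed auto
  then have le: "(cmod (f b))\<^sup>2 \<le> K\<^sup>2 / real (card B)"
    using Suc.prems by (simp add: pos_le_divide_eq card_gt_0_iff mult.commute)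
  show ?case
  proof (cases "n = 0")
    case True
    then have "card B = 1" using Suc.hyps(2) by simp
    then have "B = {b}" using b(1) by (auto simp: card_1_singleton_iff)
    then show ?thesis using le by simp
  next
    case False
    have n: "card (B - {b}) = n" using Suc b by simp
    have "(\<Sum>x\<in>B. (cmod (f x))\<^sup>2) = (cmod (f b))\<^sup>2 + (\<Sum>x\<in>B - {b}. (cmod (f x))\<^sup>2)"
      by (rule sum.remove[OF Suc.prems(1) b(1)])
    also have "\<dots> \<le> K\<^sup>2 / real (Suc n) + K\<^sup>2 * (1 + ln (real n))"
    proof (rule add_mono)
      show "(cmod (f b))\<^sup>2 \<le> K\<^sup>2 / real (Suc n)" using le by (simp only: Suc.hyps(2))
      have "B - {b} \<noteq> {}" using n False by (metis card.empty)
      then show "(\<Sum>x\<in>B - {b}. (cmod (f x))\<^sup>2) \<le> K\<^sup>2 * (1 + ln (real n))"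
        using Suc.hyps(1)[of "B - {b}"] Suc.prems(1) n by simp
    qed
    also have "\<dots> \<le> K\<^sup>2 * (1 + ln (real (Suc n)))"
    proof -
      have "ln (real n / real (Suc n)) \<le> real n / real (Suc n) - 1"
        using False by (intro ln_le_minus_one) auto
      also have "\<dots> = - (1 / real (Suc n))" by (simp add: field_simps)
      finally have "1 / real (Suc n) + ln (real n) \<le> ln (real (Suc n))"
        using False by (simp add: ln_div)
      then have "K\<^sup>2 * (1 / real (Suc n) + ln (real n)) \<le> K\<^sup>2 * ln (real (Suc n))"
        by (intro mult_left_mono) auto
      then show ?thesis by (simp add: algebra_simps)
    qed
    finally show ?thesis by (simp only: Suc.hyps(2)[symmetric])
  qed
qed auto

section \<open>Square-summable functions on the vertices\<close>

lemma has_sum_diff: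
  fixes f g :: "'a \<Rightarrow> real"
  assumes "(f has_sum a) A" "(g has_sum b) A"
  shows "((\<lambda>x. f x - g x) has_sum (a - b)) A"
  using has_sum_add[OF assms(1) has_sum_uminusI[OF assms(2)]] by simp

definition square_summable :: "('v \<Rightarrow> complex) \<Rightarrow> bool" where
  "square_summable u \<longleftrightarrow> (\<lambda>x. (cmod (u x))\<^sup>2) summable_on UNIV"

text \<open>An infinite sum that does not converge is 0 by convention, so a bound on
  \<open>sq_norm\<close> is informative only together with \<open>square_summable\<close>.\<close>

definition sq_norm :: "('v \<Rightarrow> complex) \<Rightarrow> real" where
  "sq_norm u = (\<Sum>\<^sub>\<infinity>x. (cmod (u x))\<^sup>2)"

lemma sq_norm_nonneg: "0 \<le> sq_norm u"
  by (simp add: sq_norm_def infsum_nonneg)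

text \<open>Cauchy-Schwarz followed by Young's inequality. The free weight \<open>t\<close> later
  allows cross terms to be split unevenly.\<close>

lemma abs_inner_le_weighted:
  fixes a b :: "'a::real_inner"
  assumes "0 < t"
  shows "\<bar>a \<bullet> b\<bar> \<le> t * (norm a)\<^sup>2 + (norm b)\<^sup>2 / (4 * t)"
proof -
  have "\<bar>a \<bullet> b\<bar> \<le> norm a * norm b" by (rule Cauchy_Schwarz_ineq2)
  moreover have "0 \<le> (2 * t * norm a - norm b)\<^sup>2" by simp
  then have "norm a * norm b \<le> t * (norm a)\<^sup>2 + (norm b)\<^sup>2 / (4 * t)"
    using assms by (simp add: field_simps power2_eq_square)
  ultimately show ?thesis by linarith
qed

lemma square_summable_inner:
  assumes "square_summable u" "square_summable v"
  shows "(\<lambda>x. u x \<bullet> v x) summable_on UNIV"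
proof (rule abs_summable_summable)
  have "(\<lambda>x. (cmod (u x))\<^sup>2 + 1 / 4 * (cmod (v x))\<^sup>2) summable_on UNIV"
    using assms unfolding square_summable_def
    by (intro summable_on_add summable_on_cmult_right)
  then show "(\<lambda>x. norm (u x \<bullet> v x)) summable_on UNIV"
    by (rule summable_on_comparison_test) (use abs_inner_le_weighted[of 1] in auto)
qed

lemma square_summable_diff:
  assumes "square_summable u" "square_summable v"
  shows "square_summable (\<lambda>x. u x - v x)"
proof -
  have "(\<lambda>x. (cmod (u x))\<^sup>2 + (cmod (v x))\<^sup>2 + - 2 * (u x \<bullet> v x)) summable_on UNIV"
    using assms square_summable_inner[OF assms] unfolding square_summable_def
    by (intro summable_on_add summable_on_cmult_right)
  then show ?thesis
    unfolding square_summable_def by (simp add: power2_norm_eq_inner inner_diff inner_commute algebra_simps)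
qed

section \<open>Bilinear forms on oriented edges\<close>

context rooted_homogeneous_tree
begin

text \<open>Each edge occurs in both orientations, so exchanging the endpoints is a bijection of
  this set.\<close>

definition edges :: "('v \<times> 'v) set" where
  "edges = Sigma UNIV (\<lambda>x. {y. E x y})"

lemma has_sum_edges_fst:
  fixes F :: "'v \<Rightarrow> real"
  assumes F: "\<And>x. 0 \<le> F x" "(F has_sum S) UNIV"
  shows "((\<lambda>(x, y). F x) has_sum (real (q + 1) * S)) edges"
  unfolding edges_def
proof (rule has_sum_SigmaI)
  show inner: "((\<lambda>y. case (x, y) of (x, y) \<Rightarrow> F x) has_sum (real (q + 1) * F x)) {y. E x y}" for x
    using has_sum_finite[of "{y. E x y}" "\<lambda>y. F x"] by (simp add: card_nbrs)
  show outer: "((\<lambda>x. real (q + 1) * F x) has_sum real (q + 1) * S) UNIV"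
    using F by (intro has_sum_cmult_right)
  show "(\<lambda>(x, y). F x) summable_on Sigma UNIV (\<lambda>x. {y. E x y})"
    using inner outer F(1) by (intro summable_on_SigmaI[where g = "\<lambda>x. real (q + 1) * F x"])
      (auto simp: summable_on_def)
qed

lemma has_sum_edges_swap:
  "((\<lambda>(x, y). G y x) has_sum S) edges \<longleftrightarrow> ((\<lambda>(x, y). G x y) has_sum S) edges"
  by (rule has_sum_reindex_bij_witness[where i = prod.swap and j = prod.swap])
    (auto simp: edges_def adj_sym)

text \<open>A Schur test: Young's inequality is applied on each oriented edge, and every vertex
  occurs \<open>q + 1\<close> times as a first and \<open>q + 1\<close> times as a second
  endpoint.\<close>

lemma edge_form_bound:
  assumes u: "square_summable u" and v: "square_summable v" and t: "0 < t"
    and k: "\<And>x y. E x y \<Longrightarrow> \<bar>k x y\<bar> \<le> \<kappa>" "0 \<le> \<kappa>"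
  shows "(\<lambda>(x, y). k x y * (u x \<bullet> v y)) summable_on edges"
    and "\<bar>\<Sum>\<^sub>\<infinity>(x, y)\<in>edges. k x y * (u x \<bullet> v y)\<bar> \<le> \<kappa> * real (q + 1) * (t * sq_norm u + sq_norm v / (4 * t))"
proof -
  let ?h = "\<lambda>(x, y). k x y * (u x \<bullet> v y)"
  let ?g = "\<lambda>(x, y). \<kappa> * (t * (cmod (u x))\<^sup>2 + (cmod (v y))\<^sup>2 / (4 * t))"
  have su: "((\<lambda>(x, y). (cmod (u x))\<^sup>2) has_sum (real (q + 1) * sq_norm u)) edges"
    using u unfolding square_summable_def sq_norm_def by (intro has_sum_edges_fst) auto
  have "((\<lambda>(x, y). (cmod (v x))\<^sup>2) has_sum (real (q + 1) * sq_norm v)) edges"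
    using v unfolding square_summable_def sq_norm_def by (intro has_sum_edges_fst) auto
  then have sv: "((\<lambda>(x, y). (cmod (v y))\<^sup>2) has_sum (real (q + 1) * sq_norm v)) edges"
    by (subst has_sum_edges_swap)
  have "((\<lambda>e. \<kappa> * (t * (case e of (x, y) \<Rightarrow> (cmod (u x))\<^sup>2) + (case e of (x, y) \<Rightarrow> (cmod (v y))\<^sup>2) / (4 * t)))
      has_sum (\<kappa> * (t * (real (q + 1) * sq_norm u) + real (q + 1) * sq_norm v / (4 * t)))) edges"
    using su sv by (intro has_sum_cmult_right has_sum_add has_sum_divide_const)
  then have g: "(?g has_sum (\<kappa> * (t * (real (q + 1) * sq_norm u) + real (q + 1) * sq_norm v / (4 * t)))) edges"
    by (simp add: case_prod_unfold)
  have le: "norm (?h e) \<le> ?g e" if "e \<in> edges" for e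
  proof -
    obtain x y where e: "e = (x, y)" "E x y" using \<open>e \<in> edges\<close> by (auto simp: edges_def)
    have "\<bar>k x y\<bar> * \<bar>u x \<bullet> v y\<bar> \<le> \<kappa> * (t * (cmod (u x))\<^sup>2 + (cmod (v y))\<^sup>2 / (4 * t))"
      using k e t by (intro mult_mono abs_inner_le_weighted) auto
    then show ?thesis by (simp add: e abs_mult)
  qed
  have abs: "(\<lambda>e. norm (?h e)) summable_on edges"
    using has_sum_imp_summable[OF g] le by (rule summable_on_comparison_test) auto
  then show "?h summable_on edges" by (rule abs_summable_summable)
  have "\<bar>infsum ?h edges\<bar> \<le> (\<Sum>\<^sub>\<infinity>e\<in>edges. norm (?h e))"
    using norm_infsum_bound[OF abs] by simp
  also have "\<dots> \<le> infsum ?g edges"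
    using abs has_sum_imp_summable[OF g] le by (rule infsum_mono)
  also have "\<dots> = \<kappa> * real (q + 1) * (t * sq_norm u + sq_norm v / (4 * t))"
    using infsumI[OF g] by (simp add: algebra_simps)
  finally show "\<bar>\<Sum>\<^sub>\<infinity>(x, y)\<in>edges. k x y * (u x \<bullet> v y)\<bar> \<le> \<kappa> * real (q + 1) * (t * sq_norm u + sq_norm v / (4 * t))" .
qed

text \<open>The neighbour sum conjugated by the weight \<open>s\<^bsup>|x|\<^esup>\<close>.\<close>

definition conj_sum :: "real \<Rightarrow> ('v \<Rightarrow> complex) \<Rightarrow> 'v \<Rightarrow> complex" where
  "conj_sum s u x = (\<Sum>y | E x y. (s ^ lev x / s ^ lev y) *\<^sub>R u y)"

text \<open>Levels of neighbours differ by exactly one, so the ratio is \<open>s\<close> or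
  \<open>1 / s\<close>. The second bound is the size of the asymmetry introduced by the weight, of
  order \<open>1 - s\<close>.\<close>

lemma weight_ratio:
  fixes s :: real
  assumes s: "0 < s" "s < 1" and "E x y"
  shows "\<bar>s ^ lev x / s ^ lev y\<bar> \<le> 1 / s"
    and "\<bar>s ^ lev x / s ^ lev y - s ^ lev y / s ^ lev x\<bar> \<le> 1 / s - s"
proof -
  have "s * s \<le> 1 * 1" using s by (intro mult_mono) auto
  then have "s \<le> 1 / s" using s by (simp add: field_simps)
  moreover have "s ^ m / s ^ Suc m = 1 / s" "s ^ Suc m / s ^ m = s" for m using s by auto
  then have "s ^ lev x / s ^ lev y = 1 / s \<and> s ^ lev y / s ^ lev x = s
      \<or> s ^ lev x / s ^ lev y = s \<and> s ^ lev y / s ^ lev x = 1 / s"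
    by (rule_tac tdist_adj_cases[OF \<open>E x y\<close>, of root]) (simp_all only: simp_thms)
  ultimately show "\<bar>s ^ lev x / s ^ lev y\<bar> \<le> 1 / s"
      "\<bar>s ^ lev x / s ^ lev y - s ^ lev y / s ^ lev x\<bar> \<le> 1 / s - s"
    using s by auto
qed

text \<open>Passes from vertices to oriented edges; the absolute convergence from the Schur test
  justifies the interchange of sums.\<close>

lemma conj_sum_form:
  assumes s: "0 < s" "s < 1" and u: "square_summable u" and v: "square_summable v"
  shows "(\<lambda>x. u x \<bullet> conj_sum s v x) summable_on UNIV"
    and "(\<Sum>\<^sub>\<infinity>x. u x \<bullet> conj_sum s v x) = (\<Sum>\<^sub>\<infinity>(x, y)\<in>edges. (s ^ lev x / s ^ lev y) * (u x \<bullet> v y))"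
proof -
  let ?h = "\<lambda>x y. (s ^ lev x / s ^ lev y) * (u x \<bullet> v y)"
  have sm: "(\<lambda>(x, y). ?h x y) summable_on edges"
    using weight_ratio(1)[OF s] s by (intro edge_form_bound(1)[OF u v, of 1 _ "1 / s"]) auto
  have eq: "u x \<bullet> conj_sum s v x = (\<Sum>\<^sub>\<infinity>y\<in>{y. E x y}. ?h x y)" for x
    by (simp add: conj_sum_def inner_sum_right)
  show "(\<lambda>x. u x \<bullet> conj_sum s v x) summable_on UNIV"
    unfolding eq using summable_on_Sigma_banach sm unfolding edges_def by blast
  show "(\<Sum>\<^sub>\<infinity>x. u x \<bullet> conj_sum s v x) = (\<Sum>\<^sub>\<infinity>(x, y)\<in>edges. ?h x y)"
    unfolding eq edges_def by (rule infsum_Sigma'_banach) (use sm edges_def in simp)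
qed

text \<open>Reversing all edges turns the second form into the first with the weight ratio inverted.
  The difference is again an edge form, with kernel at most \<open>1 / s - s\<close>.\<close>

lemma conj_sum_almost_symmetric:
  assumes s: "0 < s" "s < 1" and u: "square_summable u" and v: "square_summable v" and t: "0 < t"
  shows "\<bar>(\<Sum>\<^sub>\<infinity>x. u x \<bullet> conj_sum s v x) - (\<Sum>\<^sub>\<infinity>x. v x \<bullet> conj_sum s u x)\<bar>
    \<le> (1 / s - s) * real (q + 1) * (t * sq_norm u + sq_norm v / (4 * t))"
proof -
  let ?c = "\<lambda>x y. s ^ lev x / s ^ lev y"
  have sm1: "(\<lambda>(x, y). ?c x y * (u x \<bullet> v y)) summable_on edges"
    using weight_ratio(1)[OF s] s by (intro edge_form_bound(1)[OF u v, of 1 _ "1 / s"]) auto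
  have "(\<lambda>(x, y). ?c x y * (v x \<bullet> u y)) summable_on edges"
    using weight_ratio(1)[OF s] s by (intro edge_form_bound(1)[OF v u, of 1 _ "1 / s"]) auto
  then have "((\<lambda>(x, y). ?c x y * (v x \<bullet> u y)) has_sum (\<Sum>\<^sub>\<infinity>x. v x \<bullet> conj_sum s u x)) edges"
    unfolding conj_sum_form(2)[OF s v u] by simp
  then have "((\<lambda>(x, y). ?c y x * (u x \<bullet> v y)) has_sum (\<Sum>\<^sub>\<infinity>x. v x \<bullet> conj_sum s u x)) edges"
    by (subst (asm) has_sum_edges_swap[symmetric]) (simp add: inner_commute)
  from has_sum_diff[OF has_sum_infsum[OF sm1] this]
  have "(\<Sum>\<^sub>\<infinity>x. u x \<bullet> conj_sum s v x) - (\<Sum>\<^sub>\<infinity>x. v x \<bullet> conj_sum s u x)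
      = (\<Sum>\<^sub>\<infinity>(x, y)\<in>edges. (?c x y - ?c y x) * (u x \<bullet> v y))"
    unfolding conj_sum_form(2)[OF s u v]
    by (intro infsumI[symmetric]) (simp add: case_prod_unfold left_diff_distrib)
  moreover have "s * s \<le> 1 * 1" using s by (intro mult_mono) auto
  then have "0 \<le> 1 / s - s" using s by (simp add: field_simps)
  ultimately show ?thesis
    using edge_form_bound(2)[OF u v t, of "\<lambda>x y. ?c x y - ?c y x" "1 / s - s"] weight_ratio(2)[OF s]
    by simp
qed

section \<open>Almost convexity of the norms along a weighted orbit\<close>

text \<open>For \<beta> the reciprocal of the eigenvalue \<gamma>, this is the Laplacian divided by
  \<gamma> and conjugated by the weight, as \<open>conj_lap_weighted\<close> shows.\<close>

definition conj_lap :: "real \<Rightarrow> real \<Rightarrow> ('v \<Rightarrow> complex) \<Rightarrow> 'v \<Rightarrow> complex" where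
  "conj_lap \<beta> s u x = \<beta> *\<^sub>R (u x - (1 / real (q + 1)) *\<^sub>R conj_sum s u x)"

lemma conj_sum_diff: "conj_sum s (\<lambda>x. u x - v x) x = conj_sum s u x - conj_sum s v x"
  by (simp add: conj_sum_def scaleR_diff_right sum_subtractf)

lemma conj_lap_diff: "conj_lap \<beta> s (\<lambda>x. u x - v x) x = conj_lap \<beta> s u x - conj_lap \<beta> s v x"
  by (simp add: conj_lap_def conj_sum_diff algebra_simps)

text \<open>Let \<open>A\<close> be \<open>conj_lap\<close> and \<open>w = A u0 - u0\<close>. For
  self-adjoint \<open>A\<close> the second difference equals \<open>||(A + 1) w||^2\<close>, which
  is at least \<open>||w||^2\<close> when \<open>A\<close> is positive. The weight disturbs both
  properties slightly, and a quarter of \<open>||w||^2\<close> survives at the cost of a multiple of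
  \<open>d^2\<close>.\<close>

lemma second_difference_sq_norm:
  assumes s: "0 < s" "s < 1" and \<beta>: "0 < \<beta>" and d: "d = \<beta> * (1 / s - s)" "d \<le> 1 / 4"
    and u0: "square_summable u0" and u1: "square_summable u1" and u2: "square_summable u2"
    and eq1: "u1 = conj_lap \<beta> s u0" and eq2: "u2 = conj_lap \<beta> s u1"
  shows "sq_norm (\<lambda>x. u1 x - u0 x) / 4 - 4 * d\<^sup>2 * sq_norm u0 \<le> sq_norm u2 - 2 * sq_norm u1 + sq_norm u0"
proof -
  define w where "w x = u1 x - u0 x" for x
  define w1 where "w1 x = u2 x - u1 x" for x
  define b where "b = \<beta> / real (q + 1)"
  have w: "square_summable w" "square_summable w1"
    unfolding w_def w1_def using u0 u1 u2 by (auto intro: square_summable_diff)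
  have w1: "w1 x = \<beta> *\<^sub>R w x - b *\<^sub>R conj_sum s w x" for x
    unfolding w1_def eq2 eq1[symmetric] w_def b_def
    by (subst (2) eq1) (simp add: conj_lap_def conj_sum_diff algebra_simps)
  have w0: "w x = (\<beta> - 1) *\<^sub>R u0 x - b *\<^sub>R conj_sum s u0 x" for x
    unfolding w_def b_def by (simp add: eq1 conj_lap_def algebra_simps)
  let ?ww = "\<Sum>\<^sub>\<infinity>x. w x \<bullet> conj_sum s w x"
  let ?uw = "\<Sum>\<^sub>\<infinity>x. u0 x \<bullet> conj_sum s w x" and ?wu = "\<Sum>\<^sub>\<infinity>x. w x \<bullet> conj_sum s u0 x"
  \<comment> \<open>The expansion with the square of \<open>w1\<close> dropped. After summation the
    two terms mixing \<open>u0\<close> and \<open>w\<close> would cancel for a symmetric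
    operator.\<close>
  have pt: "(1 + 2 * \<beta>) * (cmod (w x))\<^sup>2 - 2 * b * (w x \<bullet> conj_sum s w x)
      - 2 * b * (u0 x \<bullet> conj_sum s w x) + 2 * b * (w x \<bullet> conj_sum s u0 x)
      \<le> (cmod (u2 x))\<^sup>2 - 2 * (cmod (u1 x))\<^sup>2 + (cmod (u0 x))\<^sup>2" for x
  proof -
    have "u1 x = u0 x + w x" "u2 x = u0 x + w x + w1 x" by (simp_all add: w_def w1_def)
    then have "(cmod (u2 x))\<^sup>2 - 2 * (cmod (u1 x))\<^sup>2 + (cmod (u0 x))\<^sup>2
        = (cmod (w x))\<^sup>2 + 2 * (w x \<bullet> w1 x) + (cmod (w1 x))\<^sup>2 + 2 * (u0 x \<bullet> w1 x - u0 x \<bullet> w x - w x \<bullet> w x)"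
      by (simp add: power2_norm_eq_inner inner_add inner_commute algebra_simps)
    moreover have "w x \<bullet> w1 x = \<beta> * (cmod (w x))\<^sup>2 - b * (w x \<bullet> conj_sum s w x)"
      by (simp add: w1 inner_diff_right power2_norm_eq_inner)
    moreover have "u0 x \<bullet> w1 x - u0 x \<bullet> w x - w x \<bullet> w x
        = - b * (u0 x \<bullet> conj_sum s w x) + b * (w x \<bullet> conj_sum s u0 x)"
    proof -
      have "u0 x \<bullet> w1 x = \<beta> * (u0 x \<bullet> w x) - b * (u0 x \<bullet> conj_sum s w x)"
        by (simp add: w1 inner_diff_right)
      moreover have "w x \<bullet> w x = w x \<bullet> ((\<beta> - 1) *\<^sub>R u0 x - b *\<^sub>R conj_sum s u0 x)"
        using w0 by simp
      then have "w x \<bullet> w x = (\<beta> - 1) * (u0 x \<bullet> w x) - b * (w x \<bullet> conj_sum s u0 x)"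
        by (simp add: inner_diff_right inner_commute)
      ultimately show ?thesis by (simp add: algebra_simps)
    qed
    moreover have "0 \<le> (cmod (w1 x))\<^sup>2" by simp
    moreover have "(cmod (w x))\<^sup>2 = w x \<bullet> w x" by (rule power2_norm_eq_inner)
    ultimately show ?thesis by (simp add: distrib_right)
  qed
  have sums: "(\<lambda>x. w x \<bullet> conj_sum s w x) summable_on UNIV" "(\<lambda>x. u0 x \<bullet> conj_sum s w x) summable_on UNIV"
      "(\<lambda>x. w x \<bullet> conj_sum s u0 x) summable_on UNIV"
    by (intro conj_sum_form(1)[OF s] w u0)+
  have sq: "((\<lambda>x. (cmod (u x))\<^sup>2) has_sum sq_norm u) UNIV" if "square_summable u" for u :: "'v \<Rightarrow> complex"
    using that by (simp add: square_summable_def sq_norm_def)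
  have "(1 + 2 * \<beta>) * sq_norm w - 2 * b * ?ww - 2 * b * ?uw + 2 * b * ?wu
      \<le> sq_norm u2 - 2 * sq_norm u1 + sq_norm u0"
  proof (rule has_sum_mono)
    show "((\<lambda>x. (1 + 2 * \<beta>) * (cmod (w x))\<^sup>2 - 2 * b * (w x \<bullet> conj_sum s w x)
        - 2 * b * (u0 x \<bullet> conj_sum s w x) + 2 * b * (w x \<bullet> conj_sum s u0 x))
      has_sum ((1 + 2 * \<beta>) * sq_norm w - 2 * b * ?ww - 2 * b * ?uw + 2 * b * ?wu)) UNIV"
      by (intro has_sum_add has_sum_diff has_sum_cmult_right sq w has_sum_infsum sums)
    show "((\<lambda>x. (cmod (u2 x))\<^sup>2 - 2 * (cmod (u1 x))\<^sup>2 + (cmod (u0 x))\<^sup>2)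
      has_sum (sq_norm u2 - 2 * sq_norm u1 + sq_norm u0)) UNIV"
      by (intro has_sum_add has_sum_diff has_sum_cmult_right sq u0 u1 u2)
  qed (rule pt)
  \<comment> \<open>Almost positivity: the neighbour sum has norm at most
    \<open>(q + 1) / s\<close>; the weight \<open>1/2\<close> splits Young's inequality
    evenly.\<close>
  moreover have "b * ?ww \<le> \<beta> / s * sq_norm w"
  proof -
    have "?ww \<le> 1 / s * real (q + 1) * (1 / 2 * sq_norm w + sq_norm w / (4 * (1 / 2)))"
      unfolding conj_sum_form(2)[OF s w(1) w(1)]
      using edge_form_bound(2)[OF w(1) w(1), of "1 / 2" "\<lambda>x y. s ^ lev x / s ^ lev y" "1 / s"]
        weight_ratio(1)[OF s] s by simp
    then have "b * ?ww \<le> b * (1 / s * real (q + 1) * sq_norm w)"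
      using \<beta> by (intro mult_left_mono) (auto simp: b_def)
    also have "\<dots> = b * real (q + 1) / s * sq_norm w"
      by (simp only: times_divide_eq_left times_divide_eq_right mult_1 mult.assoc)
    also have "b * real (q + 1) = \<beta>" by (simp add: b_def)
    finally show ?thesis .
  qed
  moreover have "s * s < 1 * 1" using s by (intro mult_strict_mono) auto
  then have "0 < 1 / s - s" using s by (simp add: field_simps)
  then have dpos: "0 < d" using d(1) \<beta> by simp
  \<comment> \<open>The weight \<open>2 d\<close> in Young's inequality leaves exactly one eighth of
    the norm of \<open>w\<close> and a coefficient quadratic in \<open>d\<close> for
    \<open>u0\<close>.\<close>
  have "b * (?uw - ?wu) \<le> 2 * d\<^sup>2 * sq_norm u0 + sq_norm w / 8"
  proof -
    have "?uw - ?wu \<le> (1 / s - s) * real (q + 1) * (2 * d * sq_norm u0 + sq_norm w / (4 * (2 * d)))"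
      using conj_sum_almost_symmetric[OF s u0 w(1), of "2 * d"] dpos by linarith
    then have "b * (?uw - ?wu) \<le> b * ((1 / s - s) * real (q + 1) * (2 * d * sq_norm u0 + sq_norm w / (4 * (2 * d))))"
      using \<beta> by (intro mult_left_mono) (auto simp: b_def)
    also have "\<dots> = d * (2 * d * sq_norm u0 + sq_norm w / (4 * (2 * d)))"
      using d(1) by (simp add: b_def)
    also have "\<dots> = 2 * d\<^sup>2 * sq_norm u0 + sq_norm w / 8"
      using dpos by (simp add: field_simps power2_eq_square)
    finally show ?thesis .
  qed
  \<comment> \<open>Since \<open>s < 1\<close>, the excess \<open>\<beta> / s - \<beta>\<close> is
    at most \<open>d\<close>. The total coefficient of the norm of \<open>w\<close> becomes
    \<open>1 + 2 \<beta> - 2 (\<beta> + 1/4) - 2/8 = 1/4\<close>.\<close>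
  moreover have "\<beta> / s * sq_norm w \<le> (\<beta> + 1 / 4) * sq_norm w"
  proof (rule mult_right_mono)
    have "\<beta> * (1 / s) \<le> d + \<beta> * 1"
      using \<beta> s unfolding d(1) by (simp add: algebra_simps)
    with d(2) show "\<beta> / s \<le> \<beta> + 1 / 4" by simp
  qed (rule sq_norm_nonneg)
  ultimately have "sq_norm w / 4 - 4 * d\<^sup>2 * sq_norm u0 \<le> sq_norm u2 - 2 * sq_norm u1 + sq_norm u0"
    by (simp add: algebra_simps)
  then show ?thesis by (simp add: w_def[abs_def])
qed

text \<open>By linearity the increments form an orbit of the same operator. The second difference
  estimate is applied to the orbit, keeping the gain, and to the increments, discarding it; these
  are the two inputs of \<open>bounded_convexity_estimate\<close>.\<close>

lemma orbit_increment_bound: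
  assumes s: "0 < s" "s < 1" and \<beta>: "0 < \<beta>" and d: "d = \<beta> * (1 / s - s)" "d \<le> 1 / 4"
    and v: "\<And>k. square_summable (v k)" "\<And>k. sq_norm (v k) \<le> N"
    and orbit: "\<And>k::int. v (k + 1) = conj_lap \<beta> s (v k)"
    and J: "0 < J" "8 * d\<^sup>2 * (real J)\<^sup>2 \<le> 1"
  shows "sq_norm (\<lambda>x. v (k + 1) x - v k x) \<le> N * (32 * d\<^sup>2 + 16 / (real J)\<^sup>2)"
proof -
  define w where "w k = (\<lambda>x. v (k + 1) x - v k x)" for k
  have w: "square_summable (w k)" for k unfolding w_def using v(1) by (intro square_summable_diff)
  have w_orbit: "w (k + 1) = conj_lap \<beta> s (w k)" for k
    unfolding w_def conj_lap_diff[abs_def] using orbit[of k] orbit[of "k + 1"] by simp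
  have shift: "k + 2 = k + 1 + 1" for k :: int by simp
  have "sq_norm (w k) \<le> N * (32 * d\<^sup>2 + 16 / (real J)\<^sup>2)"
  proof (rule bounded_convexity_estimate[where \<phi> = "\<lambda>k. sq_norm (v k)" and \<psi> = "\<lambda>k. sq_norm (w k)"])
    show "sq_norm (w k) / 4 - 4 * d\<^sup>2 * sq_norm (v k) \<le> sq_norm (v (k + 2)) - 2 * sq_norm (v (k + 1)) + sq_norm (v k)" for k
      unfolding w_def shift by (rule second_difference_sq_norm[OF s \<beta> d v(1) v(1) v(1) orbit orbit])
    show "- 4 * d\<^sup>2 * sq_norm (w k) \<le> sq_norm (w (k + 2)) - 2 * sq_norm (w (k + 1)) + sq_norm (w k)" for k
      using second_difference_sq_norm[OF s \<beta> d w w w w_orbit w_orbit, of k]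
        sq_norm_nonneg[of "\<lambda>x. w (k + 1) x - w k x"] unfolding shift by linarith
    \<comment> \<open>A crude parallelogram bound: only finiteness of the supremum is at stake
      here.\<close>
    show "bdd_above (range (\<lambda>k. sq_norm (w k)))"
    proof (rule bdd_aboveI2)
      fix k
      have "sq_norm (w k) \<le> 2 * sq_norm (v (k + 1)) + 2 * sq_norm (v k)"
      proof -
        have "(cmod (w k x))\<^sup>2 \<le> 2 * (cmod (v (k + 1) x))\<^sup>2 + 2 * (cmod (v k x))\<^sup>2" for x
        proof -
          have "0 \<le> (cmod (v (k + 1) x + v k x))\<^sup>2" by simp
          then show ?thesis by (simp add: w_def power2_norm_eq_inner inner_add inner_diff inner_commute)
        qed
        moreover have sq: "((\<lambda>x. (cmod (u x))\<^sup>2) has_sum sq_norm u) UNIV" if "square_summable u" for u :: "'v \<Rightarrow> complex"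
          using that by (simp add: square_summable_def sq_norm_def)
        have "((\<lambda>x. 2 * (cmod (v (k + 1) x))\<^sup>2 + 2 * (cmod (v k x))\<^sup>2)
            has_sum (2 * sq_norm (v (k + 1)) + 2 * sq_norm (v k))) UNIV"
          by (intro has_sum_add has_sum_cmult_right sq v(1))
        ultimately show ?thesis using has_sum_mono[OF sq[OF w]] by blast
      qed
      also have "\<dots> \<le> 4 * N" using v(2)[of k] v(2)[of "k + 1"] by linarith
      finally show "sq_norm (w k) \<le> 4 * N" .
    qed
  qed (use sq_norm_nonneg v J in auto)
  then show ?thesis by (simp add: w_def)
qed

text \<open>Linear growth over balls becomes a geometric series over spheres by Abel summation.
  Comparing the ratio \<open>s^2\<close> with \<open>s\<close> gives the simpler bound
  \<open>1 / (1 - s)\<close>.\<close>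

lemma weighted_sq_norm:
  fixes g :: "'v \<Rightarrow> complex"
  assumes g: "\<And>n. (\<Sum>x | lev x \<le> n. (cmod (g x))\<^sup>2) \<le> C * real (n + 1)" and C: "0 \<le> C"
    and s: "0 < s" "s < 1"
  shows "square_summable (\<lambda>x. s ^ lev x *\<^sub>R g x)"
    and "sq_norm (\<lambda>x. s ^ lev x *\<^sub>R g x) \<le> C / (1 - s)"
proof -
  let ?F = "\<lambda>x. (cmod (s ^ lev x *\<^sub>R g x))\<^sup>2"
  have bound: "sum ?F A \<le> C / (1 - s)" if "finite A" for A
  proof -
    define n where "n = Max (insert 0 (lev ` A))"
    have "A \<subseteq> {x. lev x \<le> n}" using \<open>finite A\<close> by (auto simp: n_def)
    then have "sum ?F A \<le> (\<Sum>x | lev x \<le> n. ?F x)" by (intro sum_mono2) auto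
    also have "\<dots> = (\<Sum>j\<le>n. (s\<^sup>2) ^ j * (\<Sum>x\<in>sphere j. (cmod (g x))\<^sup>2))"
      unfolding sum_ball_spheres sum_distrib_left using s
      by (intro sum.cong refl) (auto simp: sphere_def power_mult_distrib power_mult[symmetric] mult.commute norm_power)
    also have "\<dots> \<le> C * (\<Sum>j\<le>n. (s\<^sup>2) ^ j)"
      using g s by (intro sum_power_mult_le) (auto simp: sum_ball_spheres power_le_one)
    also have "\<dots> \<le> C * (1 / (1 - s))"
    proof (rule mult_left_mono[OF _ C])
      have "(\<Sum>j\<le>n. (s\<^sup>2) ^ j) \<le> (\<Sum>j\<le>n. s ^ j)"
        using s by (intro sum_mono) (simp add: power_mult[symmetric] power_decreasing)
      also have "\<dots> = (1 - s ^ Suc n) / (1 - s)"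
        using s by (subst sum_gp0) auto
      also have "\<dots> \<le> 1 / (1 - s)" using s by (intro divide_right_mono) auto
      finally show "(\<Sum>j\<le>n. (s\<^sup>2) ^ j) \<le> 1 / (1 - s)" .
    qed
    finally show ?thesis by simp
  qed
  show sq: "square_summable (\<lambda>x. s ^ lev x *\<^sub>R g x)"
    unfolding square_summable_def
    by (rule nonneg_bdd_above_summable_on) (use bound in \<open>auto intro!: bdd_aboveI2\<close>)
  show "sq_norm (\<lambda>x. s ^ lev x *\<^sub>R g x) \<le> C / (1 - s)"
    unfolding sq_norm_def using sq bound
    by (intro infsum_le_finite_sums) (auto simp: square_summable_def)
qed

lemma conj_lap_weighted:
  assumes "0 < s" "\<gamma> \<noteq> 0" and "\<And>x. tree_lap E q g x = of_real \<gamma> * h x"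
  shows "(\<lambda>x. s ^ lev x *\<^sub>R h x) = conj_lap (1 / \<gamma>) s (\<lambda>x. s ^ lev x *\<^sub>R g x)"
proof
  fix x
  have "h x = (1 / \<gamma>) *\<^sub>R tree_lap E q g x" using assms by (simp add: scaleR_conv_of_real)
  also have "tree_lap E q g x = g x - (1 / real (q + 1)) *\<^sub>R (\<Sum>y | E x y. g y)"
    by (simp add: tree_lap_def scaleR_conv_of_real)
  finally have "s ^ lev x *\<^sub>R h x
      = (1 / \<gamma>) *\<^sub>R (s ^ lev x *\<^sub>R g x - (1 / real (q + 1)) *\<^sub>R (s ^ lev x *\<^sub>R (\<Sum>y | E x y. g y)))"
    by (simp only: scaleR_diff_right scaleR_left_commute)
  also have "s ^ lev x *\<^sub>R (\<Sum>y | E x y. g y) = conj_sum s (\<lambda>x. s ^ lev x *\<^sub>R g x) x"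
    using assms(1) by (simp add: conj_sum_def scaleR_sum_right)
  finally show "s ^ lev x *\<^sub>R h x = conj_lap (1 / \<gamma>) s (\<lambda>x. s ^ lev x *\<^sub>R g x) x"
    by (simp add: conj_lap_def)
qed

text \<open>With \<open>1 - s\<close> of order \<open>1 / J\<close>, the norms are
  \<open>O(J)\<close> and the increment estimate gains a factor \<open>O(1 / J^2)\<close>, so the
  increment at the root is \<open>O(1 / J)\<close> in square and vanishes in the limit.\<close>

lemma bounded_orbit_fixed_at_root:
  fixes g :: "int \<Rightarrow> 'v \<Rightarrow> complex"
  assumes \<gamma>: "0 < \<gamma>" and orbit: "\<And>k x. tree_lap E q (g k) x = of_real \<gamma> * g (k + 1) x"
    and ball: "\<And>k n. (\<Sum>x | lev x \<le> n. (cmod (g k x))\<^sup>2) \<le> C * real (n + 1)"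
  shows "g 1 root = g 0 root"
proof -
  define \<beta> where "\<beta> = 1 / \<gamma>"
  have \<beta>: "0 < \<beta>" using \<gamma> by (simp add: \<beta>_def)
  have "0 \<le> (\<Sum>x | lev x \<le> 0. (cmod (g 0 x))\<^sup>2)" by (rule sum_nonneg) simp
  also have "\<dots> \<le> C * real (0 + 1)" by (rule ball)
  finally have C: "0 \<le> C" by simp
  have est: "(cmod (g 1 root - g 0 root))\<^sup>2 \<le> 240 * C * (\<beta> + 1) / real J" if "0 < J" for J :: nat
  proof -
    \<comment> \<open>Chosen so that \<open>d \<le> 1 / (3 J)\<close>, whence
      \<open>8 d^2 J^2 \<le> 8/9\<close>.\<close>
    define \<sigma> where "\<sigma> = 1 / (12 * (\<beta> + 1) * real J)"
    define s where "s = 1 - \<sigma>"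
    define d where "d = \<beta> * (1 / s - s)"
    have J: "1 \<le> real J" using that by simp
    have "1 * 1 \<le> (\<beta> + 1) * real J" using \<beta> J by (intro mult_mono) auto
    then have \<sigma>: "0 < \<sigma>" "\<sigma> \<le> 1 / 12" by (auto simp: \<sigma>_def field_simps)
    then have s: "0 < s" "s < 1" "1 / 2 \<le> s" by (auto simp: s_def)
    have "1 / s - s = \<sigma> * ((1 + s) / s)" using s by (simp add: s_def field_simps)
    also have "\<dots> \<le> \<sigma> * 4" using s \<sigma> by (intro mult_left_mono) (auto simp: field_simps)
    finally have "d \<le> \<beta> * (\<sigma> * 4)" unfolding d_def using \<beta> by (intro mult_left_mono) auto
    also have "\<dots> \<le> (\<beta> + 1) * (\<sigma> * 4)" using \<sigma> by (intro mult_right_mono) auto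
    also have "\<dots> = \<sigma> * (12 * (\<beta> + 1) * real J) / (3 * real J)" using that by simp
    also have "\<sigma> * (12 * (\<beta> + 1) * real J) = 1" using \<beta> that by (simp add: \<sigma>_def)
    finally have d_le: "d \<le> 1 / (3 * real J)" .
    have "s * s \<le> 1 * 1" using s by (intro mult_mono) auto
    then have d0: "0 \<le> d" unfolding d_def using \<beta> s by (simp add: field_simps)
    have d2: "d\<^sup>2 \<le> 1 / (9 * (real J)\<^sup>2)"
      using power_mono[OF d_le d0, of 2] by (simp add: power_divide power_mult_distrib)
    have C_J: "C / (1 - s) = 12 * C * (\<beta> + 1) * real J" using \<beta> J by (simp add: s_def \<sigma>_def)
    let ?v = "\<lambda>k x. s ^ lev x *\<^sub>R g k x"
    have "sq_norm (\<lambda>x. ?v (0 + 1) x - ?v 0 x) \<le> C / (1 - s) * (32 * d\<^sup>2 + 16 / (real J)\<^sup>2)"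
    proof (rule orbit_increment_bound[where v = ?v and d = d])
      show "\<And>k. square_summable (?v k)" "\<And>k. sq_norm (?v k) \<le> C / (1 - s)"
        by (intro weighted_sq_norm[OF ball C s(1,2)])+
      show "?v (k + 1) = conj_lap \<beta> s (?v k)" for k
        unfolding \<beta>_def using orbit \<gamma> by (intro conj_lap_weighted[OF s(1)]) auto
      \<comment> \<open>For \<open>J = 1\<close> the general bound only gives \<open>1/3\<close>;
        the sharper estimate \<open>(1 + s) / s \<le> 3\<close> repairs this case.\<close>
      show "d \<le> 1 / 4"
      proof (cases "J = 1")
        case True
        have "\<beta> * (1 / s - s) \<le> \<beta> * (\<sigma> * ((1 + s) / s))" using \<open>1 / s - s = \<sigma> * ((1 + s) / s)\<close> by simp
        also have "(1 + s) / s \<le> 3" using s by (simp add: field_simps)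
        then have "\<beta> * (\<sigma> * ((1 + s) / s)) \<le> \<beta> * (\<sigma> * 3)" using \<beta> \<sigma> by (intro mult_left_mono) auto
        also have "\<dots> \<le> 1 / 4" using \<beta> True by (simp add: \<sigma>_def divide_simps)
        finally show ?thesis by (simp add: d_def)
      next
        case False
        then have "2 \<le> real J" using that by simp
        then have "1 / (3 * real J) \<le> 1 / 4" by (simp add: field_simps)
        with d_le show ?thesis by linarith
      qed
      show "8 * d\<^sup>2 * (real J)\<^sup>2 \<le> 1" using d2 J by (simp add: field_simps)
    qed (use s \<beta> that d_def in auto)
    also have "\<dots> \<le> C / (1 - s) * (32 * (1 / (9 * (real J)\<^sup>2)) + 16 / (real J)\<^sup>2)"
      using d2 C s by (intro mult_left_mono) auto
    also have "\<dots> \<le> C / (1 - s) * (20 / (real J)\<^sup>2)"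
      using C s J by (intro mult_left_mono) (auto simp: field_simps)
    also have "\<dots> = 240 * C * (\<beta> + 1) / real J"
      unfolding C_J using J by (simp add: power2_eq_square field_simps)
    finally have sq: "sq_norm (\<lambda>x. ?v 1 x - ?v 0 x) \<le> 240 * C * (\<beta> + 1) / real J" by simp
    have "square_summable (\<lambda>x. ?v 1 x - ?v 0 x)"
      by (intro square_summable_diff weighted_sq_norm[OF ball C s(1,2)])
    \<comment> \<open>Only the root term is kept: its weight is \<open>s^0 = 1\<close>, so the
      estimate does not degenerate with \<open>s\<close>.\<close>
    then have "sum (\<lambda>x. (cmod (?v 1 x - ?v 0 x))\<^sup>2) {root} \<le> sq_norm (\<lambda>x. ?v 1 x - ?v 0 x)"
      unfolding sq_norm_def square_summable_def by (intro finite_sum_le_infsum) auto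
    with sq show ?thesis by simp
  qed
  have "(cmod (g 1 root - g 0 root))\<^sup>2 \<le> 0"
  proof (rule tendsto_lowerbound)
    show "(\<lambda>J. 240 * C * (\<beta> + 1) / real J) \<longlonglongrightarrow> 0" by (rule lim_const_over_n)
    show "\<forall>\<^sub>F J in sequentially. (cmod (g 1 root - g 0 root))\<^sup>2 \<le> 240 * C * (\<beta> + 1) / real J"
      using eventually_gt_at_top[of 0] by eventually_elim (rule est)
  qed simp
  then show ?thesis by simp
qed

end

subsection \<open>Boundary values of eigenfunctions\<close>

context prob_space
begin

text \<open>The arithmetic-geometric mean inequality gives
  \<open>|Y| \<le> e/2 + |Y|^2 / (2 e)\<close>, and the total mass is one.\<close>

lemma L1_less_of_L2_less:
  fixes Y :: "'a \<Rightarrow> complex"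
  assumes [measurable]: "Y \<in> borel_measurable M"
    and int: "integrable M (\<lambda>x. (cmod (Y x))\<^sup>2)" and e: "0 < e" "(LINT x|M. (cmod (Y x))\<^sup>2) < e\<^sup>2"
  shows "integrable M Y" and "(LINT x|M. cmod (Y x)) < e"
proof -
  have le: "cmod (Y x) \<le> e / 2 + (cmod (Y x))\<^sup>2 / (2 * e)" for x
  proof -
    have "0 \<le> (cmod (Y x) - e)\<^sup>2" by simp
    then show ?thesis using e by (simp add: field_simps power2_eq_square)
  qed
  have int': "integrable M (\<lambda>x. e / 2 + (cmod (Y x))\<^sup>2 / (2 * e))"
    using int by auto
  show "integrable M Y"
    by (rule Bochner_Integration.integrable_bound[OF int'])
      (use le in \<open>auto intro!: AE_I2 intro: order_trans[OF _ abs_ge_self]\<close>)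
  then have "(LINT x|M. cmod (Y x)) \<le> (LINT x|M. e / 2 + (cmod (Y x))\<^sup>2 / (2 * e))"
    using int' le by (intro integral_mono) auto
  also have "\<dots> = e / 2 + (LINT x|M. (cmod (Y x))\<^sup>2) / (2 * e)"
    using int by (simp add: prob_space)
  also have "\<dots> < e" using e by (simp add: field_simps power2_eq_square)
  finally show "(LINT x|M. cmod (Y x)) < e" .
qed

text \<open>Fatou's lemma for squares; the bound is stated eventually so that it fits tails of
  Cauchy sequences.\<close>

lemma L2_Fatou:
  fixes Y :: "nat \<Rightarrow> 'a \<Rightarrow> complex"
  assumes [measurable]: "\<And>j. Y j \<in> borel_measurable M" "Z \<in> borel_measurable M"
    and lim: "AE x in M. (\<lambda>j. Y j x) \<longlonglongrightarrow> Z x"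
    and int: "\<And>j. integrable M (\<lambda>x. (cmod (Y j x))\<^sup>2)"
    and B: "\<forall>\<^sub>F j in sequentially. (LINT x|M. (cmod (Y j x))\<^sup>2) \<le> B"
  shows "integrable M (\<lambda>x. (cmod (Z x))\<^sup>2)" and "(LINT x|M. (cmod (Z x))\<^sup>2) \<le> B"
proof -
  have "0 \<le> B"
  proof -
    obtain j where "(LINT x|M. (cmod (Y j x))\<^sup>2) \<le> B"
      using eventually_happens'[OF sequentially_bot B] by blast
    moreover have "0 \<le> (LINT x|M. (cmod (Y j x))\<^sup>2)" by (rule Bochner_Integration.integral_nonneg) simp
    ultimately show ?thesis by linarith
  qed
  have "(\<integral>\<^sup>+x. ennreal ((cmod (Z x))\<^sup>2) \<partial>M) = (\<integral>\<^sup>+x. liminf (\<lambda>j. ennreal ((cmod (Y j x))\<^sup>2)) \<partial>M)"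
  proof (rule nn_integral_cong_AE)
    show "AE x in M. ennreal ((cmod (Z x))\<^sup>2) = liminf (\<lambda>j. ennreal ((cmod (Y j x))\<^sup>2))"
      using lim
    proof eventually_elim
      case (elim x)
      then have "(\<lambda>j. ennreal ((cmod (Y j x))\<^sup>2)) \<longlonglongrightarrow> ennreal ((cmod (Z x))\<^sup>2)"
        by (intro tendsto_intros)
      then show ?case using lim_imp_Liminf[OF sequentially_bot] by metis
    qed
  qed
  also have "\<dots> \<le> liminf (\<lambda>j. \<integral>\<^sup>+x. ennreal ((cmod (Y j x))\<^sup>2) \<partial>M)"
    by (rule nn_integral_liminf) measurable
  also have "\<dots> \<le> liminf (\<lambda>j. ennreal B)"
  proof (rule Liminf_mono)
    show "\<forall>\<^sub>F j in sequentially. (\<integral>\<^sup>+x. ennreal ((cmod (Y j x))\<^sup>2) \<partial>M) \<le> ennreal B"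
      using B by eventually_elim (simp add: nn_integral_eq_integral[OF int] ennreal_leI)
  qed
  also have "\<dots> = ennreal B" by (rule lim_imp_Liminf) auto
  finally have le: "(\<integral>\<^sup>+x. ennreal ((cmod (Z x))\<^sup>2) \<partial>M) \<le> ennreal B" .
  then show intZ: "integrable M (\<lambda>x. (cmod (Z x))\<^sup>2)"
    by (intro integrableI_bounded) (auto simp: le_less_trans)
  show "(LINT x|M. (cmod (Z x))\<^sup>2) \<le> B"
    using le \<open>0 \<le> B\<close> by (simp add: nn_integral_eq_integral[OF intZ])
qed

text \<open>L^2-Cauchy implies L^1-Cauchy, which yields a subsequence converging almost everywhere.
  Fatou puts the limit in L^2. Convergence is recorded in L^1, which is enough for testing against
  bounded functions.\<close>

lemma L2_Cauchy_limit:
  fixes X :: "nat \<Rightarrow> 'a \<Rightarrow> complex"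
  assumes X [measurable]: "\<And>n. X n \<in> borel_measurable M"
    and int: "\<And>n. integrable M (\<lambda>x. (cmod (X n x))\<^sup>2)"
      "\<And>n m. integrable M (\<lambda>x. (cmod (X n x - X m x))\<^sup>2)"
    and Cauchy: "\<And>e. 0 < e \<Longrightarrow> \<exists>N. \<forall>i\<ge>N. \<forall>j\<ge>N. (LINT x|M. (cmod (X i x - X j x))\<^sup>2) < e"
    and B: "\<And>n. (LINT x|M. (cmod (X n x))\<^sup>2) \<le> B"
  obtains F r where "F \<in> borel_measurable M" "integrable M F" "integrable M (\<lambda>x. (cmod (F x))\<^sup>2)"
    "strict_mono r" "(\<lambda>i. LINT x|M. cmod (X (r i) x - F x)) \<longlonglongrightarrow> 0"
proof -
  have intX: "integrable M (X n)" for n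
  proof (rule L1_less_of_L2_less(1)[OF X int(1)])
    have "0 \<le> (LINT x|M. (cmod (X n x))\<^sup>2)" by (rule Bochner_Integration.integral_nonneg) simp
    then have "0 \<le> B" using B[of n] by linarith
    then show "0 < B + 1" by simp
    have "0 \<le> B * B" by simp
    then have "B < B * B + 2 * B + 1" using \<open>0 \<le> B\<close> by linarith
    also have "\<dots> = (B + 1)\<^sup>2" by (simp add: power2_eq_square algebra_simps)
    finally have "B < (B + 1)\<^sup>2" .
    then show "(LINT x|M. (cmod (X n x))\<^sup>2) < (B + 1)\<^sup>2" using B[of n] by linarith
  qed
  have "\<exists>N. \<forall>i\<ge>N. \<forall>j\<ge>N. (LINT x|M. norm (X i x - X j x)) < e" if e: "0 < e" for e
  proof -
    obtain N where "\<forall>i\<ge>N. \<forall>j\<ge>N. (LINT x|M. (cmod (X i x - X j x))\<^sup>2) < e\<^sup>2"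
      using Cauchy[OF zero_less_power[OF e]] by blast
    then have "\<forall>i\<ge>N. \<forall>j\<ge>N. (LINT x|M. cmod (X i x - X j x)) < e"
      by (auto intro!: L1_less_of_L2_less(2)[OF _ int(2) e])
    then show ?thesis by blast
  qed
  from cauchy_L1_AE_cauchy_subseq[OF intX this]
  obtain r where r: "strict_mono r" "AE x in M. Cauchy (\<lambda>i. X (r i) x)" by blast
  define F where "F x = lim (\<lambda>i. X (r i) x)" for x
  have F [measurable]: "F \<in> borel_measurable M" unfolding F_def by measurable
  have lim: "AE x in M. (\<lambda>i. X (r i) x) \<longlonglongrightarrow> F x"
    using r(2) by eventually_elim (simp add: F_def Cauchy_convergent_iff convergent_LIMSEQ_iff)
  have intF2: "integrable M (\<lambda>x. (cmod (F x))\<^sup>2)"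
    by (rule L2_Fatou(1)[OF _ F lim int(1), where B = B]) (use B in auto)
  have L1: "\<exists>N. \<forall>i\<ge>N. integrable M (\<lambda>x. X (r i) x - F x) \<and> (LINT x|M. cmod (X (r i) x - F x)) < e" if e: "0 < e" for e
  proof -
    obtain N where N: "\<forall>i\<ge>N. \<forall>j\<ge>N. (LINT x|M. (cmod (X i x - X j x))\<^sup>2) < (e / 2)\<^sup>2"
      using Cauchy[OF zero_less_power[OF half_gt_zero[OF e]]] by blast
    have ge: "N \<le> r i" if "N \<le> i" for i using seq_suble[OF r(1), of i] that by linarith
    have "integrable M (\<lambda>x. X (r i) x - F x) \<and> (LINT x|M. cmod (X (r i) x - F x)) < e" if "N \<le> i" for i
    proof -
      \<comment> \<open>Fatou is applied in the second index while the first stays fixed.\<close>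
      have lim': "AE x in M. (\<lambda>j. X (r i) x - X (r j) x) \<longlonglongrightarrow> X (r i) x - F x"
        using lim by eventually_elim (intro tendsto_intros)
      have ev: "\<forall>\<^sub>F j in sequentially. (LINT x|M. (cmod (X (r i) x - X (r j) x))\<^sup>2) \<le> (e / 2)\<^sup>2"
        using eventually_ge_at_top[of N] by eventually_elim (use N ge that in \<open>auto intro: less_imp_le\<close>)
      have 1: "integrable M (\<lambda>x. (cmod (X (r i) x - F x))\<^sup>2)"
        and 2: "(LINT x|M. (cmod (X (r i) x - F x))\<^sup>2) \<le> (e / 2)\<^sup>2"
        by (rule L2_Fatou[OF _ _ lim' int(2) ev]; measurable)+
      have "(e / 2)\<^sup>2 < e\<^sup>2" using \<open>0 < e\<close> by (intro power_strict_mono) auto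
      with 2 have "(LINT x|M. (cmod (X (r i) x - F x))\<^sup>2) < e\<^sup>2" by linarith
      from L1_less_of_L2_less[OF _ 1 \<open>0 < e\<close> this] show ?thesis by simp
    qed
    then show ?thesis by blast
  qed
  have "integrable M F"
  proof -
    obtain i where "integrable M (\<lambda>x. X (r i) x - F x)" using L1[of 1] by auto
    from Bochner_Integration.integrable_diff[OF intX[of "r i"] this] show ?thesis by simp
  qed
  moreover have "(\<lambda>i. LINT x|M. cmod (X (r i) x - F x)) \<longlonglongrightarrow> 0"
    by (rule LIMSEQ_I) (use L1 in \<open>force simp: integral_nonneg\<close>)
  ultimately show ?thesis using that F intF2 r(1) by blast
qed

end

section \<open>Rays and heights\<close>

context rooted_homogeneous_tree
begin

context
  fixes \<omega> :: "nat \<Rightarrow> 'v"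
  assumes \<omega>: "\<omega> \<in> boundary E root"
begin

lemma tdist_ray: "m \<le> n \<Longrightarrow> tdist E (\<omega> m) (\<omega> n) = n - m"
  using \<omega> by (simp add: boundary_def)

lemma ray_0: "\<omega> 0 = root"
  using \<omega> by (simp add: boundary_def)

lemma lev_ray: "lev (\<omega> n) = n"
  using tdist_ray[of 0 n] ray_0 by simp

lemma parent_ray: "parent (\<omega> (Suc n)) = \<omega> n"
  using adj_if_tdist_1[of "\<omega> n" "\<omega> (Suc n)"] tdist_ray[of n "Suc n"]
  by (auto intro: parent_eqI simp: adj_sym lev_ray)

lemma funpow_parent_ray: "(parent ^^ j) (\<omega> (n + j)) = \<omega> n"
  by (induction j) (simp_all add: funpow_Suc_right parent_ray del: funpow.simps(2))

lemma descendant_ray_iff: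
  assumes "lev v \<le> m"
  shows "descendant v (\<omega> m) \<longleftrightarrow> \<omega> (lev v) = v"
proof -
  have "descendant v (\<omega> m) \<longleftrightarrow> (parent ^^ (m - lev v)) (\<omega> m) = v"
    using assms by (auto simp: descendant_def lev_ray intro: exI[of _ "m - lev v"])
  also have "(parent ^^ (m - lev v)) (\<omega> m) = \<omega> (lev v)"
    using funpow_parent_ray[of "m - lev v" "lev v"] assms by simp
  finally show ?thesis .
qed

text \<open>The sequence defining the height is constant from level |x| on. By induction towards the
  root: if the ray misses \<open>x\<close> it never meets a descendant of \<open>x\<close>, and
  distances from \<open>x\<close> exceed those from its parent by one; otherwise the distance is
  explicit.\<close>

lemma tdist_ray_stable:
  "lev x \<le> m \<Longrightarrow> real m - real (tdist E x (\<omega> m)) = real (lev x) - real (tdist E x (\<omega> (lev x)))"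
proof (induction "lev x" arbitrary: x m)
  case 0
  then show ?case using lev_ray by simp
next
  case (Suc n)
  then have x: "x \<noteq> root" by auto
  have p: "lev (parent x) = n" using parent[OF x] Suc by simp
  show ?case
  proof (cases "\<omega> (lev x) = x")
    case True
    then show ?thesis using tdist_ray[of "lev x" m] Suc.prems by (simp add: of_nat_diff)
  next
    case False
    then have "tdist E x (\<omega> k) = Suc (tdist E (parent x) (\<omega> k))" if "lev x \<le> k" for k
      using tdist_nondescendant[OF x, of "\<omega> k"] descendant_ray_iff[OF that] by simp
    then show ?thesis
      using Suc.hyps(1)[of "parent x" m] Suc.hyps(1)[of "parent x" "lev x"] p Suc.hyps(2) Suc.prems by simp
  qed
qed

lemma height_eq: "height E \<omega> x = real (lev x) - real (tdist E x (\<omega> (lev x)))"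
  unfolding height_def
proof (rule limI, rule tendsto_eventually)
  show "\<forall>\<^sub>F n in sequentially. real n - real (tdist E x (\<omega> n)) = real (lev x) - real (tdist E x (\<omega> (lev x)))"
    using eventually_ge_at_top[of "lev x"] by eventually_elim (rule tdist_ray_stable)
qed

lemma height_root: "height E \<omega> root = 0"
  by (simp add: height_eq ray_0)

lemma height_on_ray:
  assumes "v \<noteq> root" "\<omega> (lev v) = v"
  shows "height E \<omega> v = real (lev v)" and "height E \<omega> (parent v) = real (lev v - 1)"
proof -
  show "height E \<omega> v = real (lev v)" using assms by (simp add: height_eq)
  have "lev v = Suc (lev (parent v))" using parent[OF assms(1)] by simp
  moreover from this have "\<omega> (lev (parent v)) = parent v" using parent_ray assms(2) by metis
  ultimately show "height E \<omega> (parent v) = real (lev v - 1)" by (simp add: height_eq)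
qed

lemma height_off_ray:
  assumes v: "v \<noteq> root" and off: "\<omega> (lev v) \<noteq> v"
  shows "height E \<omega> v = height E \<omega> (parent v) - 1"
proof -
  have p: "lev v = Suc (lev (parent v))" using parent[OF v] by simp
  have "tdist E v (\<omega> (lev v)) = Suc (tdist E (parent v) (\<omega> (lev v)))"
    using tdist_nondescendant[OF v, of "\<omega> (lev v)"] descendant_ray_iff[of v "lev v"] off by simp
  moreover have "height E \<omega> (parent v) = real (lev v) - real (tdist E (parent v) (\<omega> (lev v)))"
    using tdist_ray_stable[of "parent v" "lev v"] p by (simp add: height_eq)
  ultimately show ?thesis using height_eq[of v] by simp
qed

end

section \<open>The finitely additive boundary measure of an eigenfunction\<close>

text \<open>Level 0 is separate because the root cylinder is the whole boundary, whereas the general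
  formula with truncated \<open>n - 1\<close> would give \<open>1 / (q + 1)\<close>.\<close>

definition cyl_mass :: "nat \<Rightarrow> real" where
  "cyl_mass n = (if n = 0 then 1 else 1 / (real (q + 1) * real q ^ (n - 1)))"

text \<open>Total mass on the descendants of \<open>v\<close> of the finitely additive boundary measure whose
  transform with kernel \<open>a\<^bsup>h\<^esup>\<close> is \<open>f\<close>: along the edge from the parent of \<open>v\<close> to \<open>v\<close>, the height
  increases exactly on these rays, so that \<open>f v - f (parent v) / a\<close> only sees them.\<close>

definition bmass :: "complex \<Rightarrow> ('v \<Rightarrow> complex) \<Rightarrow> 'v \<Rightarrow> complex" where
  "bmass a f v = (if v = root then f root
     else (f v - f (parent v) / a) / (a ^ (lev v - 1) * (a - 1 / a)))"

context
  fixes a :: complex and f :: "'v \<Rightarrow> complex"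
  assumes a_sq: "(cmod a)\<^sup>2 = real q"
    and eigen: "\<And>x. (\<Sum>y | E x y. f y) = (a + of_nat q / a) * f x"
begin

lemma a_nonzero: "a \<noteq> 0" "a - 1 / a \<noteq> 0"
proof -
  show a: "a \<noteq> 0" using a_sq q_ge_2 by auto
  show "a - 1 / a \<noteq> 0"
  proof
    assume "a - 1 / a = 0"
    then have "a\<^sup>2 = 1" using a by (simp add: field_simps power2_eq_square)
    then have "(cmod a)\<^sup>2 = 1" by (metis norm_one norm_power)
    then show False using a_sq q_ge_2 by simp
  qed
qed

lemma bmass_mult:
  "v \<noteq> root \<Longrightarrow> bmass a f v * (a ^ (lev v - 1) * (a - 1 / a)) = f v - f (parent v) / a"
  using a_nonzero by (simp add: bmass_def)

text \<open>Finite additivity is the eigenvalue equation at \<open>x\<close>: away from the root,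
  the \<open>q\<close> children contribute \<open>a\<close> times
  \<open>f x - f (parent x) / a\<close>; at the root, the \<open>q + 1\<close> children contribute
  \<open>(a - 1/a) f root\<close>.\<close>

lemma bmass_children: "(\<Sum>y\<in>children x. bmass a f y) = bmass a f x"
proof -
  have ch: "bmass a f y = (f y - f x / a) / (a ^ lev x * (a - 1 / a))" if "y \<in> children x" for y
  proof -
    have "lev y = Suc (lev x)" "y \<noteq> root" using that by (auto simp: children_def)
    then show ?thesis using parent_child[OF that] by (simp add: bmass_def)
  qed
  have sum: "(\<Sum>y\<in>children x. bmass a f y)
      = ((\<Sum>y\<in>children x. f y) - of_nat (card (children x)) * f x / a) / (a ^ lev x * (a - 1 / a))"
    by (simp add: ch sum_divide_distrib[symmetric] sum_subtractf)
  show ?thesis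
  proof (cases "x = root")
    case True
    have "(\<Sum>y\<in>children root. f y) = (a + of_nat q / a) * f root"
      using eigen[of root] nbrs_root by simp
    then have "(\<Sum>y\<in>children x. f y) - of_nat (card (children x)) * f x / a = (a - 1 / a) * f root"
      using True by (simp add: card_children ring_distribs add_divide_distrib)
    with sum True a_nonzero show ?thesis by (simp add: bmass_def)
  next
    case False
    have "f (parent x) + (\<Sum>y\<in>children x. f y) = (a + of_nat q / a) * f x"
      using eigen[of x] nbrs_eq[OF False] by simp
    then have "(\<Sum>y\<in>children x. f y) - of_nat (card (children x)) * f x / a = a * (f x - f (parent x) / a)"
      using False a_nonzero by (simp add: card_children field_simps)
    moreover have "a ^ lev x = a * a ^ (lev x - 1)"
      using parent[OF False] by (metis diff_Suc_1 power_Suc)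
    ultimately show ?thesis using sum False a_nonzero by (simp add: bmass_def)
  qed
qed

text \<open>The finite form of the martingale property: a test function of the ancestor at level
  \<open>n\<close> has the same sum at every finer level.\<close>

lemma bmass_level_sum:
  "n \<le> k \<Longrightarrow> (\<Sum>w\<in>sphere k. bmass a f w * G ((parent ^^ (k - n)) w)) = (\<Sum>v\<in>sphere n. bmass a f v * G v)"
proof (induction k rule: dec_induct)
  case (step k)
  have "(\<Sum>w\<in>sphere (Suc k). bmass a f w * G ((parent ^^ (Suc k - n)) w))
      = (\<Sum>x\<in>sphere k. \<Sum>y\<in>children x. bmass a f y * G ((parent ^^ (k - n)) x))"
    unfolding sum_sphere_Suc using step
    by (intro sum.cong refl) (simp add: Suc_diff_le funpow_Suc_right parent_child del: funpow.simps(2))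
  also have "\<dots> = (\<Sum>x\<in>sphere k. bmass a f x * G ((parent ^^ (k - n)) x))"
    by (simp add: sum_distrib_right[symmetric] bmass_children)
  finally show ?case using step by simp
qed simp

text \<open>The squared L^2 norm of the density at level \<open>n\<close>, as
  \<open>has_bochner_integral_mart_sq\<close> confirms.\<close>

definition energy :: "nat \<Rightarrow> real" where
  "energy n = (\<Sum>v\<in>sphere n. (cmod (bmass a f v))\<^sup>2) / cyl_mass n"

text \<open>The condition |a|^2 = q makes |a^n|^2 cancel the power of \<open>q\<close> in the
  cylinder mass, so the constant does not depend on the level. Each vertex is counted as a parent at
  most \<open>q + 1\<close> times.\<close>

lemma energy_Suc_le:
  "energy (Suc n) \<le> real (q + 1) / (cmod (a - 1 / a))\<^sup>2 *
     (2 * (\<Sum>v\<in>sphere (Suc n). (cmod (f v))\<^sup>2) + 4 * (\<Sum>v\<in>sphere n. (cmod (f v))\<^sup>2))"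
proof -
  let ?D = "real (q + 1) / (cmod (a - 1 / a))\<^sup>2"
  have q0: "0 < real q" using q_ge_2 by simp
  have term_eq: "(cmod (bmass a f v))\<^sup>2 / cyl_mass (Suc n) = ?D * (cmod (f v - f (parent v) / a))\<^sup>2"
    if "v \<in> sphere (Suc n)" for v
  proof -
    have v: "v \<noteq> root" "lev v = Suc n" using that by (auto simp: sphere_def)
    have "(cmod (bmass a f v))\<^sup>2 = (cmod (f v - f (parent v) / a))\<^sup>2 / (((cmod a)\<^sup>2) ^ n * (cmod (a - 1 / a))\<^sup>2)"
      using v by (simp add: bmass_def norm_divide norm_mult norm_power power_divide power_mult_distrib
          power_mult[symmetric] mult.commute)
    then have "(cmod (bmass a f v))\<^sup>2 = (cmod (f v - f (parent v) / a))\<^sup>2 / (real q ^ n * (cmod (a - 1 / a))\<^sup>2)"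
      by (simp only: a_sq)
    then show ?thesis using q0 by (simp add: cyl_mass_def)
  qed
  have le: "(cmod (f v - f (parent v) / a))\<^sup>2 \<le> 2 * (cmod (f v))\<^sup>2 + 2 / real q * (cmod (f (parent v)))\<^sup>2" for v
  proof -
    have "(cmod (f v - f (parent v) / a))\<^sup>2 \<le> (cmod (f v) + cmod (f (parent v) / a))\<^sup>2"
      by (intro power_mono norm_triangle_ineq4) auto
    also have "\<dots> \<le> 2 * (cmod (f v))\<^sup>2 + 2 * (cmod (f (parent v) / a))\<^sup>2"
      using sum_squares_bound[of "cmod (f v)" "cmod (f (parent v) / a)"] by (simp add: power2_sum)
    also have "(cmod (f (parent v) / a))\<^sup>2 = (cmod (f (parent v)))\<^sup>2 / real q"
      by (simp add: norm_divide power_divide a_sq)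
    finally show ?thesis by simp
  qed
  have "(\<Sum>v\<in>sphere (Suc n). (cmod (f (parent v)))\<^sup>2) = (\<Sum>x\<in>sphere n. real (card (children x)) * (cmod (f x))\<^sup>2)"
    unfolding sum_sphere_Suc by (simp add: parent_child)
  also have "\<dots> \<le> (\<Sum>x\<in>sphere n. real (q + 1) * (cmod (f x))\<^sup>2)"
    by (intro sum_mono mult_right_mono) (auto simp: card_children)
  finally have par: "(\<Sum>v\<in>sphere (Suc n). (cmod (f (parent v)))\<^sup>2) \<le> real (q + 1) * (\<Sum>v\<in>sphere n. (cmod (f v))\<^sup>2)"
    by (simp only: sum_distrib_left)
  have "energy (Suc n) = ?D * (\<Sum>v\<in>sphere (Suc n). (cmod (f v - f (parent v) / a))\<^sup>2)"
    by (simp only: energy_def sum_divide_distrib sum_distrib_left term_eq cong: sum.cong)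
  also have "\<dots> \<le> ?D * (\<Sum>v\<in>sphere (Suc n). 2 * (cmod (f v))\<^sup>2 + 2 / real q * (cmod (f (parent v)))\<^sup>2)"
    using le by (intro mult_left_mono sum_mono) auto
  also have "\<dots> = ?D * (2 * (\<Sum>v\<in>sphere (Suc n). (cmod (f v))\<^sup>2)
      + 2 / real q * (\<Sum>v\<in>sphere (Suc n). (cmod (f (parent v)))\<^sup>2))"
    by (simp only: sum.distrib sum_distrib_left)
  also have "\<dots> \<le> ?D * (2 * (\<Sum>v\<in>sphere (Suc n). (cmod (f v))\<^sup>2) + 4 * (\<Sum>v\<in>sphere n. (cmod (f v))\<^sup>2))"
  proof (intro mult_left_mono add_left_mono)
    have "2 / real q * (\<Sum>v\<in>sphere (Suc n). (cmod (f (parent v)))\<^sup>2)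
        \<le> 2 / real q * (real (q + 1) * (\<Sum>v\<in>sphere n. (cmod (f v))\<^sup>2))"
      using par by (intro mult_left_mono) auto
    also have "\<dots> = (2 / real q * real (q + 1)) * (\<Sum>v\<in>sphere n. (cmod (f v))\<^sup>2)" by (simp only: mult.assoc)
    also have "\<dots> \<le> 4 * (\<Sum>v\<in>sphere n. (cmod (f v))\<^sup>2)"
      using q_ge_2 by (intro mult_right_mono sum_nonneg) (auto simp: field_simps)
    finally show "2 / real q * (\<Sum>v\<in>sphere (Suc n). (cmod (f (parent v)))\<^sup>2) \<le> 4 * (\<Sum>v\<in>sphere n. (cmod (f v))\<^sup>2)" .
  qed simp
  finally show ?thesis .
qed

lemma energy_nonneg: "0 \<le> energy n"
  unfolding energy_def cyl_mass_def by (rule divide_nonneg_nonneg) (auto intro: sum_nonneg)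

text \<open>The averages are bounded by the linear growth over balls. Monotonicity is a hypothesis
  here because it comes from an integral identity that requires the measure.\<close>

lemma energy_bounded_if_mono:
  assumes mono: "\<And>n k. n \<le> k \<Longrightarrow> energy n \<le> energy k"
    and ball: "\<And>n. (\<Sum>x | lev x \<le> n. (cmod (f x))\<^sup>2) \<le> C * real (n + 1)"
  shows "energy n \<le> 2 * (energy 0 + 6 * (real (q + 1) / (cmod (a - 1 / a))\<^sup>2) * C)"
proof -
  define D where "D = real (q + 1) / (cmod (a - 1 / a))\<^sup>2"
  define s where "s n = (\<Sum>v\<in>sphere n. (cmod (f v))\<^sup>2)" for n
  have D: "0 \<le> D" by (simp add: D_def)
  have s: "0 \<le> s n" for n by (simp add: s_def sum_nonneg)
  have C: "(\<Sum>j\<le>n. s j) \<le> C * real (n + 1)" for n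
    using ball[of n] by (simp add: sum_ball_spheres s_def)
  have sums: "(\<Sum>j\<le>n. energy j) \<le> energy 0 + D * (2 * (\<Sum>j\<le>n. s j) + 4 * (\<Sum>j<n. s j))" for n
  proof (induction n)
    case 0
    then show ?case using D s[of 0] by simp
  next
    case (Suc n)
    have "energy (Suc n) \<le> D * (2 * s (Suc n) + 4 * s n)"
      unfolding D_def s_def by (rule energy_Suc_le)
    with Suc show ?case by (simp add: algebra_simps)
  qed
  have "(\<Sum>j\<le>n. energy j) \<le> (energy 0 + 6 * D * C) * real (n + 1)" for n
  proof -
    have "(\<Sum>j<n. s j) \<le> (\<Sum>j\<le>n. s j)" using s by (intro sum_mono2) auto
    then have "D * (2 * (\<Sum>j\<le>n. s j) + 4 * (\<Sum>j<n. s j)) \<le> D * (6 * (C * real (n + 1)))"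
      using C[of n] D by (intro mult_left_mono) auto
    moreover have "energy 0 * 1 \<le> energy 0 * real (n + 1)"
      by (intro mult_left_mono energy_nonneg) auto
    ultimately show ?thesis using sums[of n] by (simp add: algebra_simps)
  qed
  note linear = this
  \<comment> \<open>The window from \<open>n\<close> to \<open>2 n\<close> has \<open>n + 1\<close>
    terms, each at least \<open>energy n\<close>, while the whole sum up to \<open>2 n\<close> is
    linear.\<close>
  have "energy n * real (n + 1) = (\<Sum>j\<in>{n..2 * n}. energy n)" by simp
  also have "\<dots> \<le> (\<Sum>j\<in>{n..2 * n}. energy j)" using mono by (intro sum_mono) auto
  also have "\<dots> \<le> (\<Sum>j\<le>2 * n. energy j)" using energy_nonneg by (intro sum_mono2) auto
  also have "\<dots> \<le> (energy 0 + 6 * D * C) * real (2 * n + 1)" by (rule linear)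
  also have "\<dots> \<le> (energy 0 + 6 * D * C) * (2 * real (n + 1))"
  proof (rule mult_left_mono)
    have "0 \<le> C" using C[of 0] s[of 0] by simp
    then show "0 \<le> energy 0 + 6 * D * C" using D energy_nonneg by simp
  qed simp
  finally have "energy n * real (n + 1) \<le> (2 * (energy 0 + 6 * D * C)) * real (n + 1)"
    by (simp only: mult.assoc mult.left_commute mult.commute)
  then show ?thesis unfolding D_def[symmetric] by (rule mult_right_le_imp_le) simp
qed

end

end

section \<open>The density martingale and the Poisson transform\<close>

locale canonical_boundary = rooted_homogeneous_tree E q root
  for E :: "'v \<Rightarrow> 'v \<Rightarrow> bool" and q :: nat and root :: 'v +
  fixes \<nu> :: "(nat \<Rightarrow> 'v) measure"
  assumes canonical: "canonical_boundary_measure E q root \<nu>"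
begin

sublocale prob_space \<nu>
  using canonical by (simp add: canonical_boundary_measure_def)

lemma space_nu: "space \<nu> = boundary E root"
  using canonical by (simp add: canonical_boundary_measure_def)

definition cyl :: "nat \<Rightarrow> 'v \<Rightarrow> (nat \<Rightarrow> 'v) set" where
  "cyl n v = {\<omega> \<in> boundary E root. \<omega> n = v}"

lemma sets_cyl [measurable]: "cyl n v \<in> sets \<nu>"
proof -
  have "sets \<nu> = sigma_sets (boundary E root) {{\<omega>\<in>boundary E root. \<omega> n = v} | n v. True}"
    using canonical by (simp add: canonical_boundary_measure_def)
  then show ?thesis unfolding cyl_def by (auto intro: sigma_sets.Basic)
qed

lemma cyl_mass_pos: "0 < cyl_mass n"
  using q_ge_2 by (simp add: cyl_mass_def)

lemma measure_cyl:
  assumes "v \<in> sphere n"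
  shows "measure \<nu> (cyl n v) = cyl_mass n"
proof (cases "n = 0")
  case True
  then have "cyl n v = space \<nu>" using assms by (auto simp: cyl_def space_nu ray_0)
  then show ?thesis using True by (simp add: cyl_mass_def prob_space)
next
  case False
  have "\<forall>v n. 1 \<le> n \<longrightarrow> tdist E root v = n \<longrightarrow> emeasure \<nu> {\<omega>\<in>boundary E root. \<omega> n = v}
      = ennreal (1 / (real (q + 1) * real q ^ (n - 1)))"
    using canonical unfolding canonical_boundary_measure_def by blast
  then have "emeasure \<nu> (cyl n v) = ennreal (cyl_mass n)"
    using False assms by (auto simp: cyl_mass_def sphere_def cyl_def)
  then show ?thesis using cyl_mass_pos by (simp add: measure_def less_imp_le)
qed

text \<open>Spheres are finite, so on the boundary a function of the vertex at level
  \<open>n\<close> is a finite combination of cylinder indicators.\<close>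

lemma has_bochner_integral_level:
  fixes h :: "'v \<Rightarrow> 'b::{banach, second_countable_topology}"
  shows "has_bochner_integral \<nu> (\<lambda>\<omega>. h (\<omega> n)) (\<Sum>v\<in>sphere n. cyl_mass n *\<^sub>R h v)"
proof -
  have "has_bochner_integral \<nu> (\<lambda>\<omega>. \<Sum>v\<in>sphere n. indicator (cyl n v) \<omega> *\<^sub>R h v)
      (\<Sum>v\<in>sphere n. measure \<nu> (cyl n v) *\<^sub>R h v)"
    by (intro has_bochner_integral_sum has_bochner_integral_indicator) (auto simp: less_top[symmetric])
  then have sum: "has_bochner_integral \<nu> (\<lambda>\<omega>. \<Sum>v\<in>sphere n. indicator (cyl n v) \<omega> *\<^sub>R h v)
      (\<Sum>v\<in>sphere n. cyl_mass n *\<^sub>R h v)"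
    by (simp add: measure_cyl cong: sum.cong)
  have eq: "(\<Sum>v\<in>sphere n. indicator (cyl n v) \<omega> *\<^sub>R h v) = h (\<omega> n)" if "\<omega> \<in> space \<nu>" for \<omega>
  proof -
    have \<omega>: "\<omega> \<in> boundary E root" using that by (simp add: space_nu)
    have "(\<Sum>v\<in>sphere n. indicator (cyl n v) \<omega> *\<^sub>R h v) = (\<Sum>v\<in>sphere n. if v = \<omega> n then h v else 0)"
      using \<omega> by (intro sum.cong refl) (auto simp: cyl_def indicator_def)
    also have "\<dots> = h (\<omega> n)" using lev_ray[OF \<omega>] by (simp add: sphere_def[symmetric]) (simp add: sphere_def)
    finally show ?thesis .
  qed
  show ?thesis
    by (rule has_bochner_integral_cong[THEN iffD1, OF refl eq refl sum])
qed

lemmas integrable_level = has_bochner_integral_level[THEN integrable.intros]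

definition transform_kernel :: "complex \<Rightarrow> 'v \<Rightarrow> (nat \<Rightarrow> 'v) \<Rightarrow> complex" where
  "transform_kernel c x \<omega> = exp (c * of_real (height E \<omega> x * ln (real q)))"

lemma transform_kernel_eq:
  "transform_kernel c x \<omega> = complex_of_real (poisson_kernel E q x \<omega>) powr c"
  using q_ge_2 by (simp add: transform_kernel_def poisson_kernel_def powr_def Ln_of_real flip: exp_of_real)

text \<open>The kernel at \<open>x\<close> sees a ray only through its vertex at level |x|, so it is
  among the test functions of that level.\<close>

lemma transform_kernel_level:
  assumes "\<omega> \<in> boundary E root"
  shows "transform_kernel c x \<omega>
    = exp (c * of_real ((real (lev x) - real (tdist E x (\<omega> (lev x)))) * ln (real q)))"
  by (simp add: transform_kernel_def height_eq[OF assms])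

context
  fixes a :: complex and f :: "'v \<Rightarrow> complex"
  assumes a_sq: "(cmod a)\<^sup>2 = real q"
    and eigen: "\<And>x. (\<Sum>y | E x y. f y) = (a + of_nat q / a) * f x"
begin

definition mart :: "nat \<Rightarrow> (nat \<Rightarrow> 'v) \<Rightarrow> complex" where
  "mart n \<omega> = bmass a f (\<omega> n) / of_real (cyl_mass n)"

lemma mart_measurable [measurable]: "mart n \<in> borel_measurable \<nu>"
  unfolding mart_def[abs_def]
  using integrable_level[of "\<lambda>v. bmass a f v / of_real (cyl_mass n)" n] by (rule borel_measurable_integrable)

lemma has_bochner_integral_mart:
  fixes G :: "'v \<Rightarrow> complex"
  assumes "n \<le> k"
  shows "has_bochner_integral \<nu> (\<lambda>\<omega>. G (\<omega> n) * mart k \<omega>) (\<Sum>v\<in>sphere n. bmass a f v * G v)"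
proof -
  let ?h = "\<lambda>w. G ((parent ^^ (k - n)) w) * (bmass a f w / of_real (cyl_mass k))"
  have "(\<Sum>w\<in>sphere k. cyl_mass k *\<^sub>R ?h w) = (\<Sum>w\<in>sphere k. bmass a f w * G ((parent ^^ (k - n)) w))"
    using cyl_mass_pos[of k] by (intro sum.cong refl) (simp add: scaleR_conv_of_real)
  also have "\<dots> = (\<Sum>v\<in>sphere n. bmass a f v * G v)" by (rule bmass_level_sum[OF a_sq eigen assms])
  finally have "has_bochner_integral \<nu> (\<lambda>\<omega>. ?h (\<omega> k)) (\<Sum>v\<in>sphere n. bmass a f v * G v)"
    using has_bochner_integral_level[of ?h k] by simp
  moreover have "?h (\<omega> k) = G (\<omega> n) * mart k \<omega>" if "\<omega> \<in> space \<nu>" for \<omega>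
    using that assms funpow_parent_ray[of \<omega> "k - n" n] by (simp add: mart_def space_nu)
  ultimately show ?thesis by (rule has_bochner_integral_cong[THEN iffD1, OF refl _ refl, rotated])
qed

lemma has_bochner_integral_mart_sq:
  "has_bochner_integral \<nu> (\<lambda>\<omega>. (cmod (mart n \<omega>))\<^sup>2) (energy a f n)"
proof -
  let ?h = "\<lambda>v. (cmod (bmass a f v / of_real (cyl_mass n)))\<^sup>2"
  have "(\<Sum>v\<in>sphere n. cyl_mass n *\<^sub>R ?h v) = energy a f n"
    unfolding energy_def[OF a_sq eigen] sum_divide_distrib using cyl_mass_pos[of n]
    by (intro sum.cong refl) (simp add: norm_divide power_divide power2_eq_square)
  then show ?thesis using has_bochner_integral_level[of ?h n] by (simp add: mart_def)
qed

text \<open>Orthogonality of martingale increments: testing level \<open>k\<close> against the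
  conjugate of level \<open>n\<close> gives the energy at level \<open>n\<close>.\<close>

lemma has_bochner_integral_mart_diff_sq:
  assumes "n \<le> k"
  shows "has_bochner_integral \<nu> (\<lambda>\<omega>. (cmod (mart k \<omega> - mart n \<omega>))\<^sup>2) (energy a f k - energy a f n)"
proof -
  let ?G = "\<lambda>v. cnj (bmass a f v / of_real (cyl_mass n))"
  have "(\<Sum>v\<in>sphere n. bmass a f v * ?G v) = of_real (energy a f n)"
    unfolding energy_def[OF a_sq eigen] sum_divide_distrib of_real_sum
    by (intro sum.cong refl) (simp add: complex_norm_square flip: of_real_power)
  then have "has_bochner_integral \<nu> (\<lambda>\<omega>. cnj (mart n \<omega>) * mart k \<omega>) (of_real (energy a f n))"
    using has_bochner_integral_mart[OF assms, of ?G] by (simp add: mart_def)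
  then have "has_bochner_integral \<nu> (\<lambda>\<omega>. Re (cnj (mart n \<omega>) * mart k \<omega>)) (energy a f n)"
    using has_bochner_integral_bounded_linear[OF bounded_linear_Re] by fastforce
  then have "has_bochner_integral \<nu> (\<lambda>\<omega>. (cmod (mart k \<omega>))\<^sup>2 + (cmod (mart n \<omega>))\<^sup>2
      - 2 * Re (cnj (mart n \<omega>) * mart k \<omega>)) (energy a f k + energy a f n - 2 * energy a f n)"
    by (intro has_bochner_integral_diff has_bochner_integral_add has_bochner_integral_mart_sq
        has_bochner_integral_mult_right)
  moreover have "(cmod (x - y))\<^sup>2 = (cmod x)\<^sup>2 + (cmod y)\<^sup>2 - 2 * Re (cnj y * x)" for x y
    unfolding cmod_power2 by (simp add: power2_eq_square algebra_simps)
  ultimately show ?thesis by simp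
qed

lemma energy_mono: "n \<le> k \<Longrightarrow> energy a f n \<le> energy a f k"
proof -
  assume "n \<le> k"
  from has_bochner_integral_integral_eq[OF has_bochner_integral_mart_diff_sq[OF this]]
  have "energy a f k - energy a f n = (LINT \<omega>|\<nu>. (cmod (mart k \<omega> - mart n \<omega>))\<^sup>2)" by simp
  also have "0 \<le> \<dots>" by (rule Bochner_Integration.integral_nonneg) simp
  finally show ?thesis by simp
qed

text \<open>Increasing bounded energies converge, so the martingale is L^2-Cauchy. Its integral
  against a test function of level \<open>n\<close> is constant from level \<open>n\<close> on and
  passes to the limit because such functions are bounded.\<close>

lemma ex_boundary_density:
  assumes ball: "\<And>n. (\<Sum>x | lev x \<le> n. (cmod (f x))\<^sup>2) \<le> C * real (n + 1)"
  obtains F where "F \<in> borel_measurable \<nu>" "integrable \<nu> (\<lambda>\<omega>. (cmod (F \<omega>))\<^sup>2)"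
    "\<And>n G. has_bochner_integral \<nu> (\<lambda>\<omega>. G (\<omega> n) * F \<omega>) (\<Sum>v\<in>sphere n. bmass a f v * G v)"
proof -
  let ?e = "energy a f"
  obtain B where B: "?e n \<le> B" for n
    using energy_bounded_if_mono[OF a_sq eigen energy_mono ball] by blast
  have diff_sq: "has_bochner_integral \<nu> (\<lambda>\<omega>. (cmod (mart i \<omega> - mart j \<omega>))\<^sup>2) \<bar>?e i - ?e j\<bar>" for i j
  proof (cases "j \<le> i")
    case True
    then show ?thesis using has_bochner_integral_mart_diff_sq[OF True] energy_mono[OF True] by simp
  next
    case False
    then show ?thesis using has_bochner_integral_mart_diff_sq[of i j] energy_mono[of i j]
      by (simp add: norm_minus_commute abs_minus_commute)
  qed
  have "incseq ?e" by (simp add: incseq_def energy_mono)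
  then obtain L where "?e \<longlonglongrightarrow> L" using incseq_convergent[of ?e B] B by blast
  then have "Cauchy ?e" by (rule LIMSEQ_imp_Cauchy)
  have Cauchy: "\<exists>N. \<forall>i\<ge>N. \<forall>j\<ge>N. (LINT \<omega>|\<nu>. (cmod (mart i \<omega> - mart j \<omega>))\<^sup>2) < e" if "0 < e" for e
    using CauchyD[OF \<open>Cauchy ?e\<close> that] has_bochner_integral_integral_eq[OF diff_sq] by simp
  have bdd: "(LINT \<omega>|\<nu>. (cmod (mart n \<omega>))\<^sup>2) \<le> B" for n
    using has_bochner_integral_integral_eq[OF has_bochner_integral_mart_sq] B by simp
  obtain F r where F: "F \<in> borel_measurable \<nu>" "integrable \<nu> F" "integrable \<nu> (\<lambda>\<omega>. (cmod (F \<omega>))\<^sup>2)"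
    and r: "strict_mono r" "(\<lambda>i. LINT \<omega>|\<nu>. cmod (mart (r i) \<omega> - F \<omega>)) \<longlonglongrightarrow> 0"
    by (rule L2_Cauchy_limit[OF mart_measurable integrable.intros[OF has_bochner_integral_mart_sq]
          integrable.intros[OF diff_sq] Cauchy bdd])
  have "has_bochner_integral \<nu> (\<lambda>\<omega>. G (\<omega> n) * F \<omega>) (\<Sum>v\<in>sphere n. bmass a f v * G v)" for n G
  proof -
    define K where "K = (\<Sum>v\<in>sphere n. cmod (G v))"
    have K: "cmod (G (\<omega> n)) \<le> K" if "\<omega> \<in> space \<nu>" for \<omega>
      unfolding K_def using that lev_ray[of \<omega> n]
      by (intro member_le_sum finite_sphere) (auto simp: space_nu sphere_def[of n])
    have [measurable]: "(\<lambda>\<omega>. G (\<omega> n)) \<in> borel_measurable \<nu>"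
      using integrable_level[of G n] by (rule borel_measurable_integrable)
    note [measurable] = F(1)
    have K0: "0 \<le> K" by (simp add: K_def sum_nonneg)
    have bounded_mult: "integrable \<nu> (\<lambda>\<omega>. G (\<omega> n) * H \<omega>)" if H: "integrable \<nu> H" for H
    proof (rule Bochner_Integration.integrable_bound)
      show "integrable \<nu> (\<lambda>\<omega>. K * cmod (H \<omega>))" using H by auto
      show "(\<lambda>\<omega>. G (\<omega> n) * H \<omega>) \<in> borel_measurable \<nu>" using H by measurable
      show "AE \<omega> in \<nu>. norm (G (\<omega> n) * H \<omega>) \<le> norm (K * cmod (H \<omega>))"
        using K K0 by (intro AE_I2) (auto simp: norm_mult intro!: mult_right_mono)
    qed
    have int_mart: "integrable \<nu> (mart k)" for k
      using has_bochner_integral_mart[of 0 k "\<lambda>_. 1"] by (auto simp: has_bochner_integral_iff)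
    let ?S = "\<Sum>v\<in>sphere n. bmass a f v * G v"
    have le: "cmod (?S - (LINT \<omega>|\<nu>. G (\<omega> n) * F \<omega>)) \<le> K * (LINT \<omega>|\<nu>. cmod (mart (r i) \<omega> - F \<omega>))" if "n \<le> i" for i
    proof -
      have "n \<le> r i" using seq_suble[OF r(1), of i] that by linarith
      then have "?S = (LINT \<omega>|\<nu>. G (\<omega> n) * mart (r i) \<omega>)"
        using has_bochner_integral_mart by (simp add: has_bochner_integral_iff)
      then have "?S - (LINT \<omega>|\<nu>. G (\<omega> n) * F \<omega>) = (LINT \<omega>|\<nu>. G (\<omega> n) * (mart (r i) \<omega> - F \<omega>))"
        using bounded_mult[OF int_mart] bounded_mult[OF F(2)] by (simp add: right_diff_distrib)
      also have "cmod \<dots> \<le> (LINT \<omega>|\<nu>. cmod (G (\<omega> n) * (mart (r i) \<omega> - F \<omega>)))"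
        by (rule integral_norm_bound)
      also have "\<dots> \<le> (LINT \<omega>|\<nu>. K * cmod (mart (r i) \<omega> - F \<omega>))"
      proof (rule integral_mono)
        show "integrable \<nu> (\<lambda>\<omega>. cmod (G (\<omega> n) * (mart (r i) \<omega> - F \<omega>)))"
          using bounded_mult[of "\<lambda>\<omega>. mart (r i) \<omega> - F \<omega>"] int_mart F(2) by auto
        show "integrable \<nu> (\<lambda>\<omega>. K * cmod (mart (r i) \<omega> - F \<omega>))" using int_mart F(2) by auto
      qed (use K in \<open>auto simp: norm_mult intro!: mult_right_mono\<close>)
      finally show ?thesis by simp
    qed
    have "cmod (?S - (LINT \<omega>|\<nu>. G (\<omega> n) * F \<omega>)) \<le> 0"
    proof (rule tendsto_lowerbound)
      show "(\<lambda>i. K * (LINT \<omega>|\<nu>. cmod (mart (r i) \<omega> - F \<omega>))) \<longlonglongrightarrow> 0"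
        using tendsto_mult_right_zero[OF r(2)] .
      show "\<forall>\<^sub>F i in sequentially. cmod (?S - (LINT \<omega>|\<nu>. G (\<omega> n) * F \<omega>)) \<le> K * (LINT \<omega>|\<nu>. cmod (mart (r i) \<omega> - F \<omega>))"
        using eventually_ge_at_top[of n] by eventually_elim (rule le)
    qed simp
    then show ?thesis using bounded_mult[OF F(2)] by (simp add: has_bochner_integral_iff)
  qed
  with F that show ?thesis by blast
qed

text \<open>Induction on the level. Moving from the parent to \<open>x\<close> divides the kernel by
  \<open>a\<close>, except on rays through \<open>x\<close>; the correction there is integrated by
  the mass of \<open>x\<close>, which was defined to match.\<close>

lemma eigenfunction_eq_transform:
  assumes a: "a = exp (c * of_real (ln (real q)))"
    and F: "\<And>n G. has_bochner_integral \<nu> (\<lambda>\<omega>. G (\<omega> n) * F \<omega>) (\<Sum>v\<in>sphere n. bmass a f v * G v)"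
  shows "(LINT \<omega>|\<nu>. transform_kernel c x \<omega> * F \<omega>) = f x"
proof (induction "lev x" arbitrary: x)
  case 0
  then have x: "x = root" by simp
  have "(LINT \<omega>|\<nu>. transform_kernel c x \<omega> * F \<omega>) = (LINT \<omega>|\<nu>. 1 * F \<omega>)"
    by (intro Bochner_Integration.integral_cong refl) (simp add: x transform_kernel_def height_root space_nu)
  also have "\<dots> = f x"
    using has_bochner_integral_integral_eq[OF F[of "\<lambda>_. 1" 0]] by (simp add: x bmass_def)
  finally show ?case .
next
  case (Suc n)
  then have x: "x \<noteq> root" by auto
  let ?u = "parent x"
  have u: "lev x = Suc n" "lev ?u = n" using Suc parent[OF x] by auto
  have a0: "a \<noteq> 0" using a by simp
  have int: "integrable \<nu> (\<lambda>\<omega>. transform_kernel c y \<omega> * F \<omega>)" for y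
  proof -
    let ?G = "\<lambda>w. exp (c * of_real ((real (lev y) - real (tdist E y w)) * ln (real q)))"
    have "integrable \<nu> (\<lambda>\<omega>. ?G (\<omega> (lev y)) * F \<omega>)" by (rule integrable.intros[OF F])
    then show ?thesis
      by (rule Bochner_Integration.integrable_cong[THEN iffD1, OF refl, rotated])
        (simp add: transform_kernel_level space_nu)
  qed
  \<comment> \<open>On rays through \<open>x\<close> the kernel is \<open>a^(n + 1)\<close> instead
    of \<open>a^n / a\<close>; this is the difference.\<close>
  let ?G = "\<lambda>w. if w = x then a ^ n * (a - 1 / a) else 0"
  have pt: "transform_kernel c x \<omega> * F \<omega> = transform_kernel c ?u \<omega> * F \<omega> / a + ?G (\<omega> (lev x)) * F \<omega>"
    if "\<omega> \<in> space \<nu>" for \<omega>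
  proof -
    have \<omega>: "\<omega> \<in> boundary E root" using that by (simp add: space_nu)
    have "transform_kernel c x \<omega> = transform_kernel c ?u \<omega> / a + ?G (\<omega> (lev x))"
    proof (cases "\<omega> (lev x) = x")
      case True
      have pow: "exp (c * of_real (real m * ln (real q))) = a ^ m" for m
        unfolding a exp_of_nat_mult[symmetric] by (simp add: ac_simps)
      have "transform_kernel c x \<omega> = a ^ Suc n" "transform_kernel c ?u \<omega> = a ^ n"
        unfolding transform_kernel_def height_on_ray[OF \<omega> x True] u pow by simp_all
      then show ?thesis using True a0 by (simp add: field_simps)
    next
      case False
      have "transform_kernel c x \<omega> = transform_kernel c ?u \<omega> / a"
        unfolding transform_kernel_def height_off_ray[OF \<omega> x False] a
        by (simp add: exp_diff[symmetric] algebra_simps)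
      then show ?thesis using False by simp
    qed
    then show ?thesis by (simp add: algebra_simps)
  qed
  have "(LINT \<omega>|\<nu>. transform_kernel c x \<omega> * F \<omega>)
      = (LINT \<omega>|\<nu>. transform_kernel c ?u \<omega> * F \<omega> / a + ?G (\<omega> (lev x)) * F \<omega>)"
    by (rule Bochner_Integration.integral_cong[OF refl pt])
  also have "\<dots> = (LINT \<omega>|\<nu>. transform_kernel c ?u \<omega> * F \<omega>) / a + (LINT \<omega>|\<nu>. ?G (\<omega> (lev x)) * F \<omega>)"
    using int[of ?u] integrable.intros[OF F[of ?G "lev x"]]
    by (subst Bochner_Integration.integral_add) (auto simp: has_bochner_integral_iff)
  also have "(LINT \<omega>|\<nu>. transform_kernel c ?u \<omega> * F \<omega>) = f ?u" using Suc.hyps(1)[of ?u] u by simp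
  also have "(LINT \<omega>|\<nu>. ?G (\<omega> (lev x)) * F \<omega>) = (\<Sum>v\<in>sphere (lev x). bmass a f v * ?G v)"
    by (rule has_bochner_integral_integral_eq[OF F])
  also have "\<dots> = (\<Sum>v\<in>sphere (lev x). if v = x then bmass a f x * (a ^ n * (a - 1 / a)) else 0)"
    by (intro sum.cong refl) auto
  also have "\<dots> = bmass a f x * (a ^ n * (a - 1 / a))"
  proof -
    have "x \<in> sphere (lev x)" by (simp add: sphere_def)
    then show ?thesis by (simp add: sum.delta)
  qed
  also have "\<dots> = f x - f ?u / a"
    using bmass_mult[OF a_sq eigen x] u by simp
  finally show ?case by simp
qed

end

end

section \<open>The spectral parameter for real z\<close>

text \<open>For real \<open>z\<close> the two powers are conjugate with product \<open>q\<close>, so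
  the second is \<open>q / a\<close> and their sum is twice the real part of \<open>a\<close>. This
  is at most \<open>2 sqrt q\<close>, which is below \<open>q + 1\<close> because
  \<open>(q - 1)^2 > 0\<close>; hence positivity.\<close>

lemma gam_of_real:
  fixes z :: real
  assumes q: "2 \<le> q"
  defines "a \<equiv> complex_of_real (real q) powr (1 / 2 + \<i> * of_real z)"
  shows "(cmod a)\<^sup>2 = real q"
    and "a = exp ((1 / 2 + \<i> * of_real z) * of_real (ln (real q)))"
    and "of_nat (q + 1) * (1 - gam q (of_real z)) = a + of_nat q / a"
    and "\<exists>\<gamma>>0. gam q (of_real z) = of_real \<gamma>"
proof -
  have q0: "0 < real q" using q by simp
  let ?b = "complex_of_real (real q) powr (1 / 2 - \<i> * of_real z)"
  show a_exp: "a = exp ((1 / 2 + \<i> * of_real z) * of_real (ln (real q)))"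
    using q0 by (simp add: a_def powr_def Ln_of_real)
  have b_exp: "?b = exp ((1 / 2 - \<i> * of_real z) * of_real (ln (real q)))"
    using q0 by (simp add: powr_def Ln_of_real)
  have b_cnj: "?b = cnj a" unfolding a_exp b_exp exp_cnj by simp
  have "cmod a = exp (ln (real q) / 2)" unfolding a_exp norm_exp_eq_Re by simp
  then show norm: "(cmod a)\<^sup>2 = real q" using q0 by (simp add: power2_eq_square flip: exp_add)
  have a0: "a \<noteq> 0" unfolding a_exp by simp
  have "a * cnj a = of_nat q" using norm complex_norm_square[of a] by simp
  then have b: "?b = of_nat q / a" using a0 b_cnj by (simp add: field_simps)
  have gam: "gam q (of_real z) = 1 - (a + ?b) / of_nat (q + 1)"
    by (simp add: gam_def a_def)
  have ne: "(of_nat (q + 1) :: complex) \<noteq> 0" by (simp only: of_nat_eq_0_iff)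
  show "of_nat (q + 1) * (1 - gam q (of_real z)) = a + of_nat q / a"
    unfolding gam b using ne by (simp del: of_nat_add of_nat_Suc)
  have "a + ?b = of_real (2 * Re a)" unfolding b_cnj by (rule complex_add_cnj)
  then have eq: "gam q (of_real z) = of_real (1 - 2 * Re a / real (q + 1))"
    unfolding gam by simp
  have "(2 * sqrt (real q))\<^sup>2 < (real (q + 1))\<^sup>2"
  proof -
    have "0 < (real q - 1)\<^sup>2" using q by simp
    moreover have "(2 * sqrt (real q))\<^sup>2 = 4 * real q" by (simp add: power_mult_distrib)
    moreover have "(real (q + 1))\<^sup>2 = (real q - 1)\<^sup>2 + 4 * real q"
      by (simp add: power2_eq_square algebra_simps)
    ultimately show ?thesis by linarith
  qed
  then have "2 * sqrt (real q) < real (q + 1)" by (rule power2_less_imp_less) simp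
  moreover have "cmod a = sqrt (real q)" using norm by (metis norm_ge_zero real_sqrt_unique)
  then have "Re a \<le> sqrt (real q)" using complex_Re_le_cmod[of a] by simp
  ultimately have "2 * Re a < real (q + 1)" by linarith
  then have "0 < 1 - 2 * Re a / real (q + 1)" by (simp add: divide_less_eq)
  with eq show "\<exists>\<gamma>>0. gam q (of_real z) = of_real \<gamma>" by blast
qed

section \<open>From weak norm bounds to the eigenvalue equation and the boundary function\<close>

theorem theoremA:
  fixes E :: "'v \<Rightarrow> 'v \<Rightarrow> bool" and q :: nat and x0 :: 'v
    and f :: "'v \<Rightarrow> complex" and z :: real and fs :: "int \<Rightarrow> 'v \<Rightarrow> complex" and M :: real
  assumes tree: "hom_tree E q"
    and z: "\<forall>n::int. z \<noteq> of_int n * (tau q / 2)"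
    and f0: "fs 0 = f"
    and lap: "\<forall>k. tree_lap E q (fs k) = fs (k + 1)"
    and M: "M > 0"
    and bound: "\<forall>k. weak_Lp_norm 2 (fs k) \<le> ennreal (M * cmod (gam q (of_real z)) powi k)"
  shows "(\<forall>x. tree_lap E q f x = gam q (of_real z) * f x)
    \<and> (\<forall>\<nu>. canonical_boundary_measure E q x0 \<nu> \<longrightarrow>
           (\<exists>F. F \<in> borel_measurable \<nu> \<and> integrable \<nu> (\<lambda>\<omega>. (cmod (F \<omega>))\<^sup>2)
                \<and> f = poisson_transform E q \<nu> z F))"
proof -
  interpret homogeneous_tree E q by unfold_locales (rule tree)
  obtain \<gamma> where \<gamma>: "0 < \<gamma>" "gam q (of_real z) = of_real \<gamma>"
    using gam_of_real(4)[OF q_ge_2] by blast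
  \<comment> \<open>The normalisation makes the weak bounds uniform in \<open>k\<close>. A ball has
    at most \<open>(q + 2)^n\<close> points, so the logarithmic estimate becomes linear in the
    radius, with \<open>C\<close> independent of the centre.\<close>
  define g where "g k x = fs k x / of_real (\<gamma> powi k)" for k x
  define C where "C = M\<^sup>2 * (1 + ln (real (q + 2)))"
  have ball: "(\<Sum>x | tdist E r x \<le> n. (cmod (g k x))\<^sup>2) \<le> C * real (n + 1)" for r k n
  proof -
    let ?B = "{x. tdist E r x \<le> n}"
    have pos: "0 < \<gamma> powi k" using \<gamma> by simp
    have "r \<in> ?B" by simp
    then have ne: "?B \<noteq> {}" by blast
    have "(\<Sum>x\<in>?B. (cmod (fs k x))\<^sup>2) \<le> (M * \<gamma> powi k)\<^sup>2 * (1 + ln (real (card ?B)))"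
      using bound M pos \<gamma> ne by (intro sum_norm_sq_le_of_weak_L2) auto
    also have "\<dots> \<le> (M * \<gamma> powi k)\<^sup>2 * (1 + real n * ln (real (q + 2)))"
    proof (intro mult_left_mono add_left_mono)
      have "0 < card ?B" using ne by (simp add: card_gt_0_iff)
      then have "ln (real (card ?B)) \<le> ln (real ((q + 2) ^ n))"
        using card_ball[of r n] by (subst ln_le_cancel_iff) (auto simp del: of_nat_power)
      also have "\<dots> = real n * ln (real (q + 2))" by (simp add: ln_realpow)
      finally show "ln (real (card ?B)) \<le> real n * ln (real (q + 2))" .
    qed simp
    also have "\<dots> \<le> (M * \<gamma> powi k)\<^sup>2 * ((1 + ln (real (q + 2))) * real (n + 1))"
    proof (rule mult_left_mono)
      have "0 \<le> ln (real (q + 2))" by simp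
      then show "1 + real n * ln (real (q + 2)) \<le> (1 + ln (real (q + 2))) * real (n + 1)"
        by (simp add: algebra_simps)
    qed simp
    also have "\<dots> = (\<gamma> powi k)\<^sup>2 * (C * real (n + 1))"
      by (simp add: C_def power_mult_distrib)
    finally have "(\<Sum>x\<in>?B. (cmod (fs k x))\<^sup>2) / (\<gamma> powi k)\<^sup>2 \<le> C * real (n + 1)"
      unfolding pos_divide_le_eq[OF zero_less_power[OF pos]] by (simp only: mult.commute)
    moreover have "(cmod (g k x))\<^sup>2 = (cmod (fs k x))\<^sup>2 / (\<gamma> powi k)\<^sup>2" for x
      using pos by (simp add: g_def norm_divide power_divide norm_power_int \<gamma>(1) abs_of_pos)
    ultimately show ?thesis by (simp add: sum_divide_distrib)
  qed
  have g0: "g 0 = f" by (simp add: g_def[abs_def] f0)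
  have orbit: "tree_lap E q (g k) x = of_real \<gamma> * g (k + 1) x" for k x
  proof -
    have "tree_lap E q (g k) x = tree_lap E q (fs k) x / of_real (\<gamma> powi k)"
      by (simp add: tree_lap_def g_def diff_divide_distrib sum_divide_distrib mult.commute)
    also have "\<dots> = of_real \<gamma> * g (k + 1) x"
      using lap \<gamma> by (simp add: g_def power_int_add)
    finally show ?thesis .
  qed
  have fixed: "g 1 x = g 0 x" for x
  proof -
    \<comment> \<open>Every vertex serves as the root in turn, which turns the statement at the root
      into one everywhere.\<close>
    interpret rooted_homogeneous_tree E q x by unfold_locales
    show ?thesis by (rule bounded_orbit_fixed_at_root[where g = g, OF \<gamma>(1) orbit ball])
  qed
  have eigen: "tree_lap E q f x = gam q (of_real z) * f x" for x
    using orbit[of 0 x] fixed[of x] by (simp add: g0 \<gamma>)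
  moreover have "\<exists>F. F \<in> borel_measurable \<nu> \<and> integrable \<nu> (\<lambda>\<omega>. (cmod (F \<omega>))\<^sup>2)
      \<and> f = poisson_transform E q \<nu> z F" if \<nu>: "canonical_boundary_measure E q x0 \<nu>" for \<nu>
  proof -
    interpret canonical_boundary E q x0 \<nu> by unfold_locales (rule \<nu>)
    define a where "a = complex_of_real (real q) powr (1 / 2 + \<i> * of_real z)"
    note a = gam_of_real(1-3)[OF q_ge_2, of z, folded a_def]
    have nbr_sum: "(\<Sum>y | E x y. f y) = (a + of_nat q / a) * f x" for x
    proof -
      have "(1 - gam q (of_real z)) * f x = 1 / of_nat (q + 1) * (\<Sum>y | E x y. f y)"
        using eigen[of x] by (simp add: tree_lap_def algebra_simps)
      then have eq: "of_nat (q + 1) * ((1 - gam q (of_real z)) * f x)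
          = of_nat (q + 1) * (1 / of_nat (q + 1)) * (\<Sum>y | E x y. f y)"
        by (simp only: mult.assoc)
      have "(of_nat (q + 1) :: complex) \<noteq> 0" by (simp only: of_nat_eq_0_iff)
      then have "of_nat (q + 1) * (1 / of_nat (q + 1)) = (1 :: complex)"
        by (simp only: times_divide_eq_right mult_1_right divide_self_if if_False)
      with eq show ?thesis by (simp only: mult.assoc[symmetric] a(3) mult_1_left)
    qed
    obtain F where F: "F \<in> borel_measurable \<nu>" "integrable \<nu> (\<lambda>\<omega>. (cmod (F \<omega>))\<^sup>2)"
      "\<And>n G. has_bochner_integral \<nu> (\<lambda>\<omega>. G (\<omega> n) * F \<omega>) (\<Sum>v\<in>sphere n. bmass a f v * G v)"
      using ex_boundary_density[OF a(1) nbr_sum ball[where r = x0 and k = 0, unfolded g0]] by blast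
    have "f x = poisson_transform E q \<nu> z F x" for x
      using eigenfunction_eq_transform[OF a(1) nbr_sum a(2) F(3), of x]
      by (simp add: poisson_transform_def transform_kernel_eq)
    with F(1,2) show ?thesis by blast
  qed
  ultimately show ?thesis by blast
qed

end
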